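(* (1) Let $J_{\lambda_i}(2n_{i1},\dots,2n_{is_i})$, $i=1,\dots,p$, be Jordan tuples of which at most one has multiple maxima (i.e. $n_{i1}=n_{i2}$ for at most one $i$). Then there is a finite-dimensional complex Lie algebra whose Jordan–Kronecker invariants are these Jordan tuples together with exactly one Kronecker block, of size $1\times1$. (2) Let $q\ge2$. For any collection of Jordan tuples $J_{\lambda_i}(2n_{i1},\dots,2n_{is_i})$, $i=1,\dots,p$, there is a finite-dimensional complex Lie algebra whose Jordan–Kronecker invariants are these Jordan tuples together with exactly $q$ Kronecker blocks, all of size $1\times1$.
   Context: For a finite-dimensional complex Lie algebra $\mathfrak g$ and $x\in\mathfrak g^*$, let $\mathcal A_x$ be the skew form $(\xi,\eta)\mapsto\langle x,[\xi,\eta]\rangle$. By the Jordan–Kronecker theorem, a pair of skew forms on a finite-dimensional complex vector space admits a basis in which both are block-diagonal with Jordan $2n\times2n$ blocks with eigenvalues $\mu\in\mathbb C\cup\{\infty\}$ ($A_i=\begin{pmatrix}0&J_\mu\\-J_\mu^T&0\end{pmatrix}$, $B_i=\begin{pmatrix}0&I_n\\-I_n&0\end{pmatrix}$) and Kronecker $(2k-1)\times(2k-1)$ blocks ($k\ge1$; the $1\times1$ Kronecker block is the pair of zero $1\times1$ matrices); block data grouped by eigenvalue are unique. The JK invariants of $\mathfrak g$ are the Kronecker sizes and Jordan tuples $J_{\lambda_i}(2n_{i1},\dots,2n_{is_i})$, $n_{i1}\ge\dots\ge n_{is_i}\ge1$ (sizes of Jordan blocks with common eigenvalue $\lambda_i$;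 distinct eigenvalues regarded as distinct formal symbols) of $(\mathcal A_x,\mathcal A_a)$ for $(x,a)$ in a nonempty Zariski open subset of $\mathfrak g^*\times\mathfrak g^*$ where they are constant. A Jordan tuple has multiple maxima if $s_i\ge2$ and $n_{i1}=n_{i2}$. *)

theory Defs
  imports "Jordan_Normal_Form.Jordan_Normal_Form" "HOL-Library.Multiset"
begin

text \<open>A Lie algebra of dimension n with basis e_0..e_(n-1) is given by structure
  constants c, with [e_i, e_j] = sum over k<n of (c i j k) e_k.\<close>

definition lie_algebra :: "nat \<Rightarrow> (nat \<Rightarrow> nat \<Rightarrow> nat \<Rightarrow> complex) \<Rightarrow> bool" where
  "lie_algebra n c \<longleftrightarrow>
     (\<forall>i<n. \<forall>j<n. \<forall>k<n. c i j k = - c j i k) \<and>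
     (\<forall>i<n. \<forall>j<n. \<forall>l<n. \<forall>m<n.
        (\<Sum>k<n. c i j k * c k l m + c j l k * c k i m + c l i k * c k j m) = 0)"

text \<open>For x in the dual space (coordinates w.r.t. the dual basis), the matrix of the
  skew form A_x(xi,eta) = <x,[xi,eta]> in the basis e_i.\<close>

definition lie_form :: "nat \<Rightarrow> (nat \<Rightarrow> nat \<Rightarrow> nat \<Rightarrow> complex) \<Rightarrow> complex vec \<Rightarrow> complex mat" where
  "lie_form n c x = mat n n (\<lambda>(i,j). \<Sum>k<n. x $ k * c i j k)"

datatype eigval = Fin complex | Infty

text \<open>Jordan \<mu> m : Jordan block of size 2m x 2m with eigenvalue \<mu> (m \<ge> 1);
      Kron k : Kronecker block of size (2k-1) x (2k-1) (k \<ge> 1).\<close>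
datatype jkblock = Jordan eigval nat | Kron nat

definition skew_blk :: "complex mat \<Rightarrow> complex mat" where
  "skew_blk M = four_block_mat (0\<^sub>m (dim_row M) (dim_row M)) M
                               (- transpose_mat M) (0\<^sub>m (dim_col M) (dim_col M))"

definition kron_M1 :: "nat \<Rightarrow> complex mat" where
  "kron_M1 k = mat k (k - 1) (\<lambda>(i,j). if i = j then 1 else 0)"

definition kron_M2 :: "nat \<Rightarrow> complex mat" where
  "kron_M2 k = mat k (k - 1) (\<lambda>(i,j). if i = Suc j then 1 else 0)"

fun block_pair :: "jkblock \<Rightarrow> complex mat \<times> complex mat" where
  "block_pair (Jordan (Fin \<mu>) m) = (skew_blk (jordan_block m \<mu>), skew_blk (1\<^sub>m m))"
| "block_pair (Jordan Infty m) = (skew_blk (1\<^sub>m m), skew_blk (jordan_block m 0))"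
| "block_pair (Kron k) = (skew_blk (kron_M1 k), skew_blk (kron_M2 k))"

fun bdiag :: "complex mat list \<Rightarrow> complex mat" where
  "bdiag [] = 0\<^sub>m 0 0"
| "bdiag (M # Ms) = four_block_mat M (0\<^sub>m (dim_row M) (dim_col (bdiag Ms)))
                                   (0\<^sub>m (dim_row (bdiag Ms)) (dim_col M)) (bdiag Ms)"

fun valid_block :: "jkblock \<Rightarrow> bool" where
  "valid_block (Jordan \<mu> m) \<longleftrightarrow> m \<ge> 1"
| "valid_block (Kron k) \<longleftrightarrow> k \<ge> 1"

definition jk_decomp :: "nat \<Rightarrow> complex mat \<Rightarrow> complex mat \<Rightarrow> jkblock list \<Rightarrow> bool" where
  "jk_decomp n A B bs \<longleftrightarrow> (\<forall>b\<in>set bs. valid_block b) \<and>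
     (\<exists>P. P \<in> carrier_mat n n \<and> det P \<noteq> 0 \<and>
          transpose_mat P * A * P = bdiag (map (fst \<circ> block_pair) bs) \<and>
          transpose_mat P * B * P = bdiag (map (snd \<circ> block_pair) bs))"

fun kron_size :: "jkblock \<Rightarrow> nat list" where
  "kron_size (Kron k) = [k]"
| "kron_size (Jordan \<mu> m) = []"

fun jordan_size_at :: "eigval \<Rightarrow> jkblock \<Rightarrow> nat list" where
  "jordan_size_at \<nu> (Jordan \<mu> m) = (if \<mu> = \<nu> then [m] else [])"
| "jordan_size_at \<nu> (Kron k) = []"

fun block_eig :: "jkblock \<Rightarrow> eigval set" where
  "block_eig (Jordan \<mu> m) = {\<mu>}"
| "block_eig (Kron k) = {}"

text \<open>Invariant data of a block list: the multiset of Kronecker sizes k (block size 2k-1)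
  and the multiset of Jordan tuples; each tuple is the multiset of the n's (block size 2n)
  of the blocks with one common eigenvalue, the eigenvalues themselves being forgotten
  (treated as formal symbols).\<close>
definition jk_data :: "jkblock list \<Rightarrow> nat multiset \<times> nat multiset multiset" where
  "jk_data bs = (mset (concat (map kron_size bs)),
      image_mset (\<lambda>\<nu>. mset (concat (map (jordan_size_at \<nu>) bs)))
                 (mset_set (\<Union>b\<in>set bs. block_eig b)))"

inductive poly_fun :: "nat \<Rightarrow> (complex vec \<times> complex vec \<Rightarrow> complex) \<Rightarrow> bool" for n where
  const: "poly_fun n (\<lambda>_. c)"
| var1: "i < n \<Longrightarrow> poly_fun n (\<lambda>p. fst p $ i)"
| var2: "i < n \<Longrightarrow> poly_fun n (\<lambda>p. snd p $ i)"
| add: "poly_fun n f \<Longrightarrow> poly_fun n g \<Longrightarrow> poly_fun n (\<lambda>p. f p + g p)"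
| mult: "poly_fun n f \<Longrightarrow> poly_fun n g \<Longrightarrow> poly_fun n (\<lambda>p. f p * g p)"

definition zariski_open :: "nat \<Rightarrow> (complex vec \<times> complex vec) set \<Rightarrow> bool" where
  "zariski_open n U \<longleftrightarrow> (\<exists>F. finite F \<and> (\<forall>f\<in>F. poly_fun n f) \<and>
      U = {p \<in> carrier_vec n \<times> carrier_vec n. \<exists>f\<in>F. f p \<noteq> 0})"

definition jk_invariants :: "nat \<Rightarrow> (nat \<Rightarrow> nat \<Rightarrow> nat \<Rightarrow> complex) \<Rightarrow>
      nat multiset \<times> nat multiset multiset \<Rightarrow> bool" where
  "jk_invariants n c D \<longleftrightarrow> (\<exists>U. zariski_open n U \<and> U \<noteq> {} \<and>
      (\<forall>(x,a)\<in>U. \<exists>bs. jk_decomp n (lie_form n c x) (lie_form n c a) bs \<and> jk_data bs = D))"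

definition jordan_tuple :: "nat multiset \<Rightarrow> bool" where
  "jordan_tuple t \<longleftrightarrow> t \<noteq> {#} \<and> (\<forall>m\<in>#t. m \<ge> 1)"

definition multiple_maxima :: "nat multiset \<Rightarrow> bool" where
  "multiple_maxima t \<longleftrightarrow> size t \<ge> 2 \<and> count t (Max_mset t) \<ge> 2"

end

theory Submission
  imports Defs "HOL-Computational_Algebra.Formal_Power_Series"
begin

text \<open>
  All algebras are of the form \<open>P \<ltimes> Q\<close>, with \<open>P\<close> abelian acting by commuting operators on an
  abelian ideal \<open>Q\<close>. The form of \<open>x\<close> is then \<open>skew_blk M\<close> for the pairing matrix
  \<open>M(p, q) = \<langle>x, [p, q]\<rangle>\<close>, and the Jordan-Kronecker type is read off from pairs of such matrices up to
  simultaneous row and column operations.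

  For \<open>q \<ge> 2\<close> take \<open>[P, Q]\<close> central, spanned by \<open>z\<close>, \<open>z'\<close>, with pairing \<open>J z + I z'\<close> for a Jordan
  matrix \<open>J\<close>: a generic pair of forms spans the pencil of \<open>J\<close> and \<open>I\<close>, so its eigenvalues differ
  from those of \<open>J\<close> only by a Moebius transformation.

  For a single Kronecker block, a tuple with largest block \<open>n\<close> is realized by the ring \<open>R = C[X]/X^n\<close>
  acting on \<open>R\<close> and on a module \<open>V = C[X]/X^m\<close> for each further block, together with a copy \<open>V'\<close>
  of \<open>V\<close> which pairs with \<open>V\<close> into \<open>R\<close>. The pairing matrices are triangular Toeplitz blocks, coupled
  by \<open>R \<times> V\<close>. The coupling can be removed by a shear built from the Euler operator if \<open>m < n\<close>. If
  \<open>R\<close> is replaced by the ideal generated by \<open>X\<close> in \<open>C[X]/X^(n+1)\<close>, then \<open>m = n\<close> is allowed as well,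
  at the price of a central element; this can be afforded for one tuple only. The eigenvalue of a
  tuple is the ratio of the values of \<open>x\<close> and \<open>a\<close> at the socle of \<open>R\<close>, hence distinct tuples
  have distinct eigenvalues generically.
\<close>

section \<open>Congruence and direct sums of pencils\<close>

lemma bdiag_eq_diag_block_mat: "bdiag = diag_block_mat"
proof
  fix Ms show "bdiag Ms = diag_block_mat Ms"
    by (induction Ms) (auto simp: Let_def)
qed

abbreviation dsum :: "complex mat \<Rightarrow> complex mat \<Rightarrow> complex mat" where
  "dsum A B \<equiv> four_block_mat A (0\<^sub>m (dim_row A) (dim_col B)) (0\<^sub>m (dim_row B) (dim_col A)) B"

lemma bdiag_append: "bdiag (As @ Bs) = dsum (bdiag As) (bdiag Bs)"
  unfolding bdiag_eq_diag_block_mat using diag_block_mat_append[of As Bs] by (simp add: Let_def)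

lemma dsum_mult:
  assumes "A \<in> carrier_mat n n1" "C \<in> carrier_mat n1 n2" "B \<in> carrier_mat m m1" "D \<in> carrier_mat m1 m2"
  shows "dsum A B * dsum C D = dsum (A * C) (B * D)"
proof -
  have "dsum A B * dsum C D = four_block_mat (A * C + 0\<^sub>m n m1 * 0\<^sub>m m1 n2) (A * 0\<^sub>m n1 m2 + 0\<^sub>m n m1 * D)
     (0\<^sub>m m n1 * C + B * 0\<^sub>m m1 n2) (0\<^sub>m m n1 * 0\<^sub>m n1 m2 + B * D)"
    using assms by (subst mult_four_block_mat[where ?nr1.0 = n and ?n1.0 = n1 and ?n2.0 = m1 and ?nr2.0 = m
        and ?nc1.0 = n2 and ?nc2.0 = m2]) auto
  also have "\<dots> = dsum (A * C) (B * D)"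
    using assms by (intro cong_four_block_mat) auto
  finally show ?thesis .
qed

lemma dsum_transpose: "transpose_mat (dsum A B) = dsum (transpose_mat A) (transpose_mat B)"
  by (subst transpose_four_block_mat[where ?nr1.0 = "dim_row A" and ?nc1.0 = "dim_col A"
        and ?nr2.0 = "dim_row B" and ?nc2.0 = "dim_col B"]) auto

lemma dsum_carrier:
  "A \<in> carrier_mat n n1 \<Longrightarrow> B \<in> carrier_mat m m1 \<Longrightarrow> dsum A B \<in> carrier_mat (n + m) (n1 + m1)"
  by auto

lemma det_dsum:
  "A \<in> carrier_mat n n \<Longrightarrow> B \<in> carrier_mat m m \<Longrightarrow> det (dsum A B) = det A * det B"
  by (subst det_four_block_mat_lower_left_zero[where n = n and m = m]) auto

lemma jk_decomp_congruent:
  assumes A: "A \<in> carrier_mat n n" and B: "B \<in> carrier_mat n n"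
    and Q: "Q \<in> carrier_mat n n" "det Q \<noteq> 0"
    and dec: "jk_decomp n (transpose_mat Q * A * Q) (transpose_mat Q * B * Q) bs"
  shows "jk_decomp n A B bs"
proof -
  obtain P where P: "P \<in> carrier_mat n n" "det P \<noteq> 0"
    "transpose_mat P * (transpose_mat Q * A * Q) * P = bdiag (map (fst \<circ> block_pair) bs)"
    "transpose_mat P * (transpose_mat Q * B * Q) * P = bdiag (map (snd \<circ> block_pair) bs)"
    and v: "\<forall>b\<in>set bs. valid_block b"
    using dec unfolding jk_decomp_def by blast
  have eq: "transpose_mat (Q * P) * X * (Q * P) = transpose_mat P * (transpose_mat Q * X * Q) * P"
    if X: "X \<in> carrier_mat n n" for X
  proof -
    have c: "transpose_mat P \<in> carrier_mat n n" "transpose_mat Q \<in> carrier_mat n n"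
      using P Q by auto
    have "transpose_mat (Q * P) * X * (Q * P) = transpose_mat P * transpose_mat Q * X * (Q * P)"
      using transpose_mult[OF Q(1) P(1)] by simp
    also have "\<dots> = transpose_mat P * (transpose_mat Q * X) * (Q * P)"
      using c X P Q by (simp add: assoc_mult_mat[of _ n n _ n _ n])
    also have "\<dots> = transpose_mat P * ((transpose_mat Q * X) * (Q * P))"
      using c X P Q by (intro assoc_mult_mat[of _ n n _ n _ n]) auto
    also have "(transpose_mat Q * X) * (Q * P) = (transpose_mat Q * X * Q) * P"
      using c X P Q by (intro assoc_mult_mat[of _ n n _ n _ n, symmetric]) auto
    also have "transpose_mat P * ((transpose_mat Q * X * Q) * P)
        = transpose_mat P * (transpose_mat Q * X * Q) * P"
      using c X P Q by (intro assoc_mult_mat[of _ n n _ n _ n, symmetric]) auto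
    finally show ?thesis .
  qed
  have "det (Q * P) \<noteq> 0" using det_mult[OF Q(1) P(1)] Q P by simp
  moreover have "Q * P \<in> carrier_mat n n" using Q P by auto
  ultimately show ?thesis
    unfolding jk_decomp_def using v P(3,4) eq[OF A] eq[OF B] by metis
qed

lemma jk_decomp_dsum:
  assumes c: "A \<in> carrier_mat n n" "B \<in> carrier_mat n n" "A' \<in> carrier_mat m m" "B' \<in> carrier_mat m m"
    and d: "jk_decomp n A B bs" and d': "jk_decomp m A' B' bs'"
  shows "jk_decomp (n + m) (dsum A A') (dsum B B') (bs @ bs')"
proof -
  obtain P where P: "P \<in> carrier_mat n n" "det P \<noteq> 0"
    "transpose_mat P * A * P = bdiag (map (fst \<circ> block_pair) bs)"
    "transpose_mat P * B * P = bdiag (map (snd \<circ> block_pair) bs)"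
    using d unfolding jk_decomp_def by blast
  obtain P' where P': "P' \<in> carrier_mat m m" "det P' \<noteq> 0"
    "transpose_mat P' * A' * P' = bdiag (map (fst \<circ> block_pair) bs')"
    "transpose_mat P' * B' * P' = bdiag (map (snd \<circ> block_pair) bs')"
    using d' unfolding jk_decomp_def by blast
  have eq: "transpose_mat (dsum P P') * dsum X X' * dsum P P'
      = dsum (transpose_mat P * X * P) (transpose_mat P' * X' * P')"
    if X: "X \<in> carrier_mat n n" "X' \<in> carrier_mat m m" for X X'
    unfolding dsum_transpose
    using X P(1) P'(1) dsum_mult[of "transpose_mat P" n n X n "transpose_mat P'" m m X' m]
      dsum_mult[of "transpose_mat P * X" n n P n "transpose_mat P' * X'" m m P' m] by simp
  have "det (dsum P P') \<noteq> 0" using det_dsum[OF P(1) P'(1)] P P' by simp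
  moreover have "dsum P P' \<in> carrier_mat (n + m) (n + m)" using P P' by auto
  moreover have "\<forall>b\<in>set (bs @ bs'). valid_block b"
    using d d' unfolding jk_decomp_def by auto
  ultimately show ?thesis
    unfolding jk_decomp_def map_append bdiag_append
    using P(3,4) P'(3,4) eq[OF c(1,3)] eq[OF c(2,4)] by metis
qed

text \<open>A reordering of the basis is absorbed by permuting the rows of the transition matrix,
  which changes its determinant at most by a sign.\<close>

lemma jk_decomp_permute:
  assumes c: "A \<in> carrier_mat n n" "B \<in> carrier_mat n n" and p: "p permutes {0..<n}"
    and d: "jk_decomp n A B bs"
  shows "jk_decomp n (mat n n (\<lambda>(i,j). A $$ (p i, p j))) (mat n n (\<lambda>(i,j). B $$ (p i, p j))) bs"
proof -
  obtain P where P: "P \<in> carrier_mat n n" "det P \<noteq> 0"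
    "transpose_mat P * A * P = bdiag (map (fst \<circ> block_pair) bs)"
    "transpose_mat P * B * P = bdiag (map (snd \<circ> block_pair) bs)"
    using d unfolding jk_decomp_def by blast
  define P' where "P' = mat n n (\<lambda>(i,j). P $$ (p i, j))"
  have P'c: "P' \<in> carrier_mat n n" by (simp add: P'_def)
  have "det P' \<noteq> 0"
    using det_permute_rows[OF P(1) p] P(2) by (simp add: P'_def sign_def)
  have bij: "bij_betw p {0..<n} {0..<n}" using p by (simp add: permutes_imp_bij)
  have pl: "p i < n" if "i < n" for i using permutes_in_image[OF p, of i] that by simp
  have eq: "transpose_mat P' * mat n n (\<lambda>(i,j). X $$ (p i, p j)) * P' = transpose_mat P * X * P"
    if X: "X \<in> carrier_mat n n" for X
  proof (rule eq_matI)
    fix i j assume "i < dim_row (transpose_mat P * X * P)" "j < dim_col (transpose_mat P * X * P)"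
    hence ij: "i < n" "j < n" using P by auto
    have L: "(transpose_mat P' * mat n n (\<lambda>(i,j). X $$ (p i, p j)) * P') $$ (i,j)
        = (\<Sum>l = 0..<n. (\<Sum>k = 0..<n. P $$ (p k, i) * X $$ (p k, p l)) * P $$ (p l, j))"
      using ij P'c by (simp add: scalar_prod_def P'_def)
    have inner: "(\<Sum>k = 0..<n. P $$ (p k, i) * X $$ (p k, y)) = (\<Sum>k = 0..<n. P $$ (k, i) * X $$ (k, y))"
      for y using sum.reindex_bij_betw[OF bij, of "\<lambda>k. P $$ (k, i) * X $$ (k, y)"] .
    have R: "(transpose_mat P * X * P) $$ (i,j)
        = (\<Sum>l = 0..<n. (\<Sum>k = 0..<n. P $$ (k, i) * X $$ (k, l)) * P $$ (l, j))"
      using ij P X by (simp add: scalar_prod_def del: assoc_mult_mat)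
    show "(transpose_mat P' * mat n n (\<lambda>(i,j). X $$ (p i, p j)) * P') $$ (i,j)
        = (transpose_mat P * X * P) $$ (i,j)"
      unfolding L R inner
      using sum.reindex_bij_betw[OF bij, of "\<lambda>l. (\<Sum>k = 0..<n. P $$ (k, i) * X $$ (k, l)) * P $$ (l, j)"] .
  qed (use P P'c in auto)
  have v: "\<forall>b\<in>set bs. valid_block b" using d unfolding jk_decomp_def by auto
  show ?thesis
    unfolding jk_decomp_def using v P(3,4) P'c \<open>det P' \<noteq> 0\<close> eq[OF c(1)] eq[OF c(2)] by metis
qed

section \<open>Skew forms given by one off-diagonal block\<close>

lemma skew_blk_carrier: "M \<in> carrier_mat p r \<Longrightarrow> skew_blk M \<in> carrier_mat (p + r) (p + r)"
  unfolding skew_blk_def by auto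

lemma skew_blk_index:
  assumes "M \<in> carrier_mat p r"
  shows "i < p \<Longrightarrow> j < p \<Longrightarrow> skew_blk M $$ (i, j) = 0"
    "i < p \<Longrightarrow> b < r \<Longrightarrow> skew_blk M $$ (i, p + b) = M $$ (i, b)"
    "a < r \<Longrightarrow> j < p \<Longrightarrow> skew_blk M $$ (p + a, j) = - M $$ (j, a)"
    "a < r \<Longrightarrow> b < r \<Longrightarrow> skew_blk M $$ (p + a, p + b) = 0"
  using assms unfolding skew_blk_def by auto

lemma dsum_index:
  assumes "M \<in> carrier_mat p r" "N \<in> carrier_mat p' r'"
  shows "i < p \<Longrightarrow> j < r \<Longrightarrow> dsum M N $$ (i, j) = M $$ (i, j)"
    "i < p \<Longrightarrow> b < r' \<Longrightarrow> dsum M N $$ (i, r + b) = 0"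
    "a < p' \<Longrightarrow> j < r \<Longrightarrow> dsum M N $$ (p + a, j) = 0"
    "a < p' \<Longrightarrow> b < r' \<Longrightarrow> dsum M N $$ (p + a, r + b) = N $$ (a, b)"
  using assms by auto

text \<open>The direct sum of two such forms and the form of the direct sum of the blocks differ
  only in the order of the basis.\<close>

lemma jk_decomp_skew_blk_dsum:
  assumes M: "M1 \<in> carrier_mat p r" "M2 \<in> carrier_mat p r"
    and N: "N1 \<in> carrier_mat p' r'" "N2 \<in> carrier_mat p' r'"
    and d: "jk_decomp (p + r) (skew_blk M1) (skew_blk M2) bs"
    and d': "jk_decomp (p' + r') (skew_blk N1) (skew_blk N2) bs'"
  shows "jk_decomp ((p + p') + (r + r')) (skew_blk (dsum M1 N1)) (skew_blk (dsum M2 N2)) (bs @ bs')"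
proof -
  define n where "n = (p + p') + (r + r')"
  \<comment> \<open>\<open>\<pi>\<close> takes a position in the order rows of \<open>M\<close>,
    rows of \<open>N\<close>, columns of \<open>M\<close>, columns of \<open>N\<close> to the
    position of the same vector in the order rows of \<open>M\<close>, columns of \<open>M\<close>,
    rows of \<open>N\<close>, columns of \<open>N\<close>; \<open>\<pi>'\<close> is its
    inverse.\<close>
  define \<pi> where "\<pi> i = (if i < p then i else if i < p + p' then i + r
      else if i < p + p' + r then i - p' else i)" for i
  define \<pi>' where "\<pi>' i = (if i < p then i else if i < p + r then i + p'
      else if i < p + p' + r then i - r else i)" for i
  have "bij_betw \<pi> {0..<n} {0..<n}"
    by (rule bij_betw_byWitness[where f' = \<pi>']) (auto simp: \<pi>_def \<pi>'_def n_def)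
  hence perm: "\<pi> permutes {0..<n}"
    by (rule bij_imp_permutes) (auto simp: \<pi>_def n_def)
  have n: "n = (p + r) + (p' + r')" by (simp add: n_def)
  have \<pi>1: "\<pi> a = a" if "a < p" for a using that by (simp add: \<pi>_def)
  have \<pi>2: "\<pi> (p + a) = (p + r) + a" if "a < p'" for a using that by (simp add: \<pi>_def)
  have \<pi>3: "\<pi> ((p + p') + a) = p + a" if "a < r" for a using that by (simp add: \<pi>_def)
  have \<pi>4: "\<pi> ((p + p') + (r + a)) = (p + r) + (p' + a)" for a by (simp add: \<pi>_def)
  have cases: "(k < p) \<or> (\<exists>a<p'. k = p + a) \<or> (\<exists>a<r. k = (p + p') + a) \<or> (\<exists>a<r'. k = (p + p') + (r + a))"
    if k: "k < n" for k
  proof -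
    consider "k < p" | "p \<le> k" "k < p + p'" | "p + p' \<le> k" "k < p + p' + r" | "p + p' + r \<le> k"
      by linarith
    thus ?thesis
    proof cases
      case 2 thus ?thesis by (intro disjI2[OF disjI1] exI[of _ "k - p"]) auto
    next
      case 3 thus ?thesis by (intro disjI2[OF disjI2[OF disjI1]] exI[of _ "k - (p + p')"]) auto
    next
      case 4 thus ?thesis using k
        by (intro disjI2[OF disjI2[OF disjI2]] exI[of _ "k - (p + p' + r)"]) (auto simp: n_def)
    qed simp
  qed
  have eq: "mat n n (\<lambda>(i,j). dsum (skew_blk M) (skew_blk N) $$ (\<pi> i, \<pi> j)) = skew_blk (dsum M N)"
    if MN: "M \<in> carrier_mat p r" "N \<in> carrier_mat p' r'" for M N
  proof (rule eq_matI)
    have D: "dsum M N \<in> carrier_mat (p + p') (r + r')" using MN by auto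
    note Di = skew_blk_index[OF D] dsum_index[OF MN]
    note Si = skew_blk_index[OF MN(1)] skew_blk_index[OF MN(2)]
      dsum_index[OF skew_blk_carrier[OF MN(1)] skew_blk_carrier[OF MN(2)]]
    have lts: "a < p' \<Longrightarrow> p + a < p + p'" "a < r' \<Longrightarrow> r + a < r + r'" "a < p \<Longrightarrow> a < p + c"
      "a < r \<Longrightarrow> a < r + c" "a < r \<Longrightarrow> p + a < p + r" "a < r' \<Longrightarrow> p' + a < p' + r'"
      "a < p' \<Longrightarrow> a < p' + c" for a c by auto
    fix i j assume "i < dim_row (skew_blk (dsum M N))" "j < dim_col (skew_blk (dsum M N))"
    hence ij: "i < n" "j < n" using skew_blk_carrier[OF D] by (auto simp: n_def)
    have "dsum (skew_blk M) (skew_blk N) $$ (\<pi> i, \<pi> j) = skew_blk (dsum M N) $$ (i,j)"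
      using cases[OF ij(1)] cases[OF ij(2)]
      by (elim disjE exE conjE; simp only: \<pi>1 \<pi>2 \<pi>3 \<pi>4 Di Si lts minus_zero)
    then show "mat n n (\<lambda>(i,j). dsum (skew_blk M) (skew_blk N) $$ (\<pi> i, \<pi> j)) $$ (i,j) = skew_blk (dsum M N) $$ (i,j)"
      using ij by simp
  qed (use MN skew_blk_carrier[of "dsum M N" "p + p'" "r + r'"] in \<open>auto simp: n_def\<close>)
  have c: "dsum (skew_blk M1) (skew_blk N1) \<in> carrier_mat n n" 
    "dsum (skew_blk M2) (skew_blk N2) \<in> carrier_mat n n"
    unfolding n by (rule dsum_carrier; rule skew_blk_carrier; fact)+
  have "jk_decomp n (dsum (skew_blk M1) (skew_blk N1)) (dsum (skew_blk M2) (skew_blk N2)) (bs @ bs')"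
    unfolding n by (rule jk_decomp_dsum[OF _ _ _ _ d d']) (rule skew_blk_carrier; fact)+
  from jk_decomp_permute[OF c perm this] show ?thesis
    unfolding eq[OF M(1) N(1)] eq[OF M(2) N(2)] unfolding n_def .
qed

text \<open>Congruence by \<open>dsum (transpose_mat X) Y\<close> replaces the off-diagonal block
  \<open>M\<close> by \<open>X * M * Y\<close>. As \<open>X\<close> and \<open>Y\<close> are
  independent of each other, simultaneous row and column operations on the two blocks are
  enough.\<close>

lemma jk_decomp_skew_blk_equiv:
  assumes M: "M1 \<in> carrier_mat p r" "M2 \<in> carrier_mat p r"
    and X: "X \<in> carrier_mat p p" "det X \<noteq> 0" and Y: "Y \<in> carrier_mat r r" "det Y \<noteq> 0"
    and d: "jk_decomp (p + r) (skew_blk (X * M1 * Y)) (skew_blk (X * M2 * Y)) bs"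
  shows "jk_decomp (p + r) (skew_blk M1) (skew_blk M2) bs"
proof -
  define Q where "Q = dsum (transpose_mat X) Y"
  have Q: "Q \<in> carrier_mat (p + r) (p + r)" using X Y by (auto simp: Q_def)
  have "det Q \<noteq> 0" unfolding Q_def
    using det_dsum[of "transpose_mat X" p Y r] X Y det_transpose[OF X(1)] by simp
  have eq: "transpose_mat Q * skew_blk M * Q = skew_blk (X * M * Y)" if M: "M \<in> carrier_mat p r" for M
  proof -
    let ?T = "\<lambda>A :: complex mat. transpose_mat A"
    have tQ: "?T Q = four_block_mat X (0\<^sub>m p r) (0\<^sub>m r p) (?T Y)"
      unfolding Q_def dsum_transpose using X Y by simp
    have Q': "Q = four_block_mat (?T X) (0\<^sub>m p r) (0\<^sub>m r p) Y"
      unfolding Q_def using X Y by simp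
    have sM: "skew_blk M = four_block_mat (0\<^sub>m p p) M (- ?T M) (0\<^sub>m r r)"
      unfolding skew_blk_def using M by simp
    have "?T Q * skew_blk M = four_block_mat (X * 0\<^sub>m p p + 0\<^sub>m p r * - ?T M) (X * M + 0\<^sub>m p r * 0\<^sub>m r r)
       (0\<^sub>m r p * 0\<^sub>m p p + ?T Y * - ?T M) (0\<^sub>m r p * M + ?T Y * 0\<^sub>m r r)"
      unfolding tQ sM using X Y M
      by (subst mult_four_block_mat[where ?nr1.0 = p and ?n1.0 = p and ?n2.0 = r and ?nr2.0 = r
        and ?nc1.0 = p and ?nc2.0 = r]) auto
    also have "\<dots> = four_block_mat (0\<^sub>m p p) (X * M) (?T Y * - ?T M) (0\<^sub>m r r)"
      using X Y M by (intro cong_four_block_mat) auto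
    finally have 1: "?T Q * skew_blk M = \<dots>" .
    have "?T Q * skew_blk M * Q = four_block_mat (0\<^sub>m p p * ?T X + X * M * 0\<^sub>m r p) (0\<^sub>m p p * 0\<^sub>m p r + X * M * Y)
        (?T Y * - ?T M * ?T X + 0\<^sub>m r r * 0\<^sub>m r p) (?T Y * - ?T M * 0\<^sub>m p r + 0\<^sub>m r r * Y)"
      unfolding 1 unfolding Q' using X Y M
      by (subst mult_four_block_mat[where ?nr1.0 = p and ?n1.0 = p and ?n2.0 = r and ?nr2.0 = r
        and ?nc1.0 = p and ?nc2.0 = r]) auto
    also have "\<dots> = four_block_mat (0\<^sub>m p p) (X * M * Y) (?T Y * - ?T M * ?T X) (0\<^sub>m r r)"
      using X Y M by (intro cong_four_block_mat) auto
    also have "?T Y * - ?T M * ?T X = - ?T (X * M * Y)"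
    proof -
      have "?T (X * M * Y) = ?T Y * (?T M * ?T X)"
        using X Y M by (simp add: transpose_mult[of _ p r _ r] transpose_mult[of _ p p _ r])
      also have "\<dots> = ?T Y * ?T M * ?T X"
        using X Y M by (intro assoc_mult_mat[of _ r r _ p _ p, symmetric]) auto
      finally show ?thesis
        using X Y M by simp
    qed
    finally show ?thesis using X Y M unfolding skew_blk_def by simp
  qed
  show ?thesis
    by (rule jk_decomp_congruent[OF skew_blk_carrier[OF M(1)] skew_blk_carrier[OF M(2)] Q \<open>det Q \<noteq> 0\<close>])
      (simp add: eq M d)
qed

section \<open>Pairings with labelled rows and columns\<close>

definition lmat :: "'p list \<Rightarrow> 'q list \<Rightarrow> ('p \<Rightarrow> 'q \<Rightarrow> complex) \<Rightarrow> complex mat" where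
  "lmat Ps Qs f = mat (length Ps) (length Qs) (\<lambda>(i,j). f (Ps ! i) (Qs ! j))"

text \<open>The pencil spanned by the pairings \<open>f\<close> and \<open>g\<close> between the span of \<open>Ps\<close> and the span of
  \<open>Qs\<close>, regarded as skew forms on the direct sum.\<close>

definition pencil_type ::
  "'p list \<Rightarrow> 'q list \<Rightarrow> ('p \<Rightarrow> 'q \<Rightarrow> complex) \<Rightarrow> ('p \<Rightarrow> 'q \<Rightarrow> complex) \<Rightarrow> jkblock list \<Rightarrow> bool" where
  "pencil_type Ps Qs f g bs \<longleftrightarrow>
     jk_decomp (length Ps + length Qs) (skew_blk (lmat Ps Qs f)) (skew_blk (lmat Ps Qs g)) bs"

lemma lmat_carrier [simp]: "lmat Ps Qs f \<in> carrier_mat (length Ps) (length Qs)"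
  and lmat_dim [simp]: "dim_row (lmat Ps Qs f) = length Ps" "dim_col (lmat Ps Qs f) = length Qs"
  by (auto simp: lmat_def)

lemma lmat_cong:
  "(\<And>p q. p \<in> set Ps \<Longrightarrow> q \<in> set Qs \<Longrightarrow> f p q = g p q) \<Longrightarrow> lmat Ps Qs f = lmat Ps Qs g"
  by (auto simp: lmat_def intro!: eq_matI)

lemma lmat_zero: "lmat Ps Qs (\<lambda>_ _. 0) = 0\<^sub>m (length Ps) (length Qs)"
  by (auto simp: lmat_def)

lemma lmat_append:
  "lmat (Ps1 @ Ps2) (Qs1 @ Qs2) f =
     four_block_mat (lmat Ps1 Qs1 f) (lmat Ps1 Qs2 f) (lmat Ps2 Qs1 f) (lmat Ps2 Qs2 f)"
  by (rule eq_matI) (auto simp: lmat_def nth_append)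

lemma lmat_mult:
  assumes "distinct Qs"
  shows "lmat Ps Qs f * lmat Qs Rs g = lmat Ps Rs (\<lambda>p r. \<Sum>q\<in>set Qs. f p q * g q r)"
proof (rule eq_matI)
  fix i j assume ij: "i < dim_row (lmat Ps Rs (\<lambda>p r. \<Sum>q\<in>set Qs. f p q * g q r))"
    "j < dim_col (lmat Ps Rs (\<lambda>p r. \<Sum>q\<in>set Qs. f p q * g q r))"
  have "bij_betw ((!) Qs) {0..<length Qs} (set Qs)"
    using assms by (intro bij_betw_nth) auto
  from sum.reindex_bij_betw[OF this, of "\<lambda>q. f (Ps ! i) q * g q (Rs ! j)"]
  show "(lmat Ps Qs f * lmat Qs Rs g) $$ (i,j) = lmat Ps Rs (\<lambda>p r. \<Sum>q\<in>set Qs. f p q * g q r) $$ (i,j)"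
    using ij by (simp add: lmat_def scalar_prod_def)
qed auto

lemma lmat_add: "lmat Ps Qs f + lmat Ps Qs g = lmat Ps Qs (\<lambda>p q. f p q + g p q)"
  by (auto simp: lmat_def intro!: eq_matI)

lemma pencil_type_cong:
  assumes "\<And>p q. p \<in> set Ps \<Longrightarrow> q \<in> set Qs \<Longrightarrow> f p q = f' p q"
    and "\<And>p q. p \<in> set Ps \<Longrightarrow> q \<in> set Qs \<Longrightarrow> g p q = g' p q"
    and "pencil_type Ps Qs f' g' bs"
  shows "pencil_type Ps Qs f g bs"
  using assms lmat_cong[of Ps Qs f f'] lmat_cong[of Ps Qs g g'] unfolding pencil_type_def by simp

lemma pencil_type_append:
  assumes "\<And>p q. p \<in> set Ps1 \<Longrightarrow> q \<in> set Qs2 \<Longrightarrow> f p q = 0 \<and> g p q = 0"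
    and "\<And>p q. p \<in> set Ps2 \<Longrightarrow> q \<in> set Qs1 \<Longrightarrow> f p q = 0 \<and> g p q = 0"
    and "pencil_type Ps1 Qs1 f g bs1" "pencil_type Ps2 Qs2 f g bs2"
  shows "pencil_type (Ps1 @ Ps2) (Qs1 @ Qs2) f g (bs1 @ bs2)"
proof -
  have "lmat Ps1 Qs2 h = 0\<^sub>m (length Ps1) (length Qs2)" "lmat Ps2 Qs1 h = 0\<^sub>m (length Ps2) (length Qs1)"
    if "h = f \<or> h = g" for h
    unfolding lmat_zero[symmetric] using that assms(1,2) by (auto intro!: lmat_cong)
  hence "lmat (Ps1 @ Ps2) (Qs1 @ Qs2) h = dsum (lmat Ps1 Qs1 h) (lmat Ps2 Qs2 h)" if "h = f \<or> h = g" for h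
    using that by (simp add: lmat_append)
  thus ?thesis
    using jk_decomp_skew_blk_dsum[OF lmat_carrier lmat_carrier lmat_carrier lmat_carrier
        assms(3,4)[unfolded pencil_type_def]]
    unfolding pencil_type_def by simp
qed

lemma pencil_type_Nil: "pencil_type [] [] f g []"
proof -
  have "skew_blk (lmat [] [] h) = (0\<^sub>m 0 0 :: complex mat)" for h :: "'a \<Rightarrow> 'b \<Rightarrow> complex"
    by (rule eq_matI) (auto simp: skew_blk_def)
  thus ?thesis unfolding pencil_type_def jk_decomp_def
    by (auto intro!: exI[of _ "1\<^sub>m 0"])
qed

lemma pencil_type_concat:
  assumes "distinct ks"
    and "\<And>k p q k'. k \<in> set ks \<Longrightarrow> k' \<in> set ks \<Longrightarrow> k \<noteq> k' \<Longrightarrow> p \<in> set (P k) \<Longrightarrow> q \<in> set (Q k') \<Longrightarrow>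
        f p q = 0 \<and> g p q = 0"
    and "\<And>k. k \<in> set ks \<Longrightarrow> pencil_type (P k) (Q k) f g (D k)"
  shows "pencil_type (concat (map P ks)) (concat (map Q ks)) f g (concat (map D ks))"
  using assms
proof (induction ks)
  case Nil
  thus ?case by (simp add: pencil_type_Nil)
next
  case (Cons k ks)
  have "pencil_type (P k @ concat (map P ks)) (Q k @ concat (map Q ks)) f g (D k @ concat (map D ks))"
  proof (rule pencil_type_append)
    fix p q assume "p \<in> set (P k)" "q \<in> set (concat (map Q ks))"
    thus "f p q = 0 \<and> g p q = 0" using Cons.prems(1) Cons.prems(2)[of k _ p q] by auto
  next
    fix p q assume "p \<in> set (concat (map P ks))" "q \<in> set (Q k)"
    thus "f p q = 0 \<and> g p q = 0" using Cons.prems(1) Cons.prems(2)[of _ k p q] by auto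
  next
    show "pencil_type (P k) (Q k) f g (D k)" using Cons.prems(3) by simp
    show "pencil_type (concat (map P ks)) (concat (map Q ks)) f g (concat (map D ks))"
      using Cons.prems(1) by (intro Cons.IH Cons.prems(2,3)) auto
  qed
  thus ?case by simp
qed

lemma pencil_type_trivial_columns:
  assumes "\<And>q. q \<in> set Qs \<Longrightarrow> pencil_type [] [q] f g [Kron 1]"
  shows "pencil_type [] Qs f g (replicate (length Qs) (Kron 1))"
  using assms
proof (induction Qs)
  case (Cons q Qs)
  have "pencil_type ([] @ []) ([q] @ Qs) f g ([Kron 1] @ replicate (length Qs) (Kron 1))"
    using Cons by (intro pencil_type_append) auto
  thus ?case by simp
qed (simp add: pencil_type_Nil)

text \<open>Without rows both forms vanish on the span of \<open>Qs\<close>, and every column splits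
  off as a zero pair. This is how central elements become trivial Kronecker blocks.\<close>

lemma pencil_type_Kron1: "pencil_type [] Qs f g (replicate (length Qs) (Kron 1))"
proof (rule pencil_type_trivial_columns)
  fix q
  have "skew_blk (lmat [] [q] h) = (0\<^sub>m 1 1 :: complex mat)" for h :: "'a \<Rightarrow> 'b \<Rightarrow> complex"
    by (rule eq_matI) (auto simp: skew_blk_def)
  moreover have "skew_blk (kron_M1 1) = 0\<^sub>m 1 1" "skew_blk (kron_M2 1) = 0\<^sub>m 1 1"
    by (auto intro!: eq_matI simp: skew_blk_def kron_M1_def kron_M2_def)
  ultimately show "pencil_type [] [q] f g [Kron 1]"
    unfolding pencil_type_def jk_decomp_def by (auto intro!: exI[of _ "1\<^sub>m 1"])
qed

text \<open>The pairing matrix is block upper triangular, with diagonal blocks \<open>T\<close>,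
  \<open>G\<close> and corner \<open>K\<close>. The hypotheses are the Sylvester-type equation
  \<open>K + \<tau> G + T \<sigma> = 0\<close>, so unipotent row and column operations clear the
  corner. One choice of \<open>\<tau>\<close> and \<open>\<sigma>\<close> must serve
  \<open>f\<close> and \<open>g\<close>, since the operations are simultaneous.\<close>

lemma pencil_type_shear:
  assumes dist: "distinct Ps2" "distinct Qs1"
    and low: "\<And>p q. p \<in> set Ps2 \<Longrightarrow> q \<in> set Qs1 \<Longrightarrow> f p q = 0 \<and> g p q = 0"
    and f0: "\<And>p q. p \<in> set Ps1 \<Longrightarrow> q \<in> set Qs2 \<Longrightarrow>
        f p q + (\<Sum>k\<in>set Ps2. \<tau> p k * f k q) + (\<Sum>k\<in>set Qs1. f p k * \<sigma> k q) = 0"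
    and g0: "\<And>p q. p \<in> set Ps1 \<Longrightarrow> q \<in> set Qs2 \<Longrightarrow>
        g p q + (\<Sum>k\<in>set Ps2. \<tau> p k * g k q) + (\<Sum>k\<in>set Qs1. g p k * \<sigma> k q) = 0"
    and t: "pencil_type Ps1 Qs1 f g bs1" "pencil_type Ps2 Qs2 f g bs2"
  shows "pencil_type (Ps1 @ Ps2) (Qs1 @ Qs2) f g (bs1 @ bs2)"
proof -
  define p1 p2 q1 q2 where l: "p1 = length Ps1" "p2 = length Ps2" "q1 = length Qs1" "q2 = length Qs2"
  define X where "X = four_block_mat (1\<^sub>m p1) (lmat Ps1 Ps2 \<tau>) (0\<^sub>m p2 p1) (1\<^sub>m p2)"
  define Y where "Y = four_block_mat (1\<^sub>m q1) (lmat Qs1 Qs2 \<sigma>) (0\<^sub>m q2 q1) (1\<^sub>m q2)"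
  have c: "lmat Ps1 Ps2 \<tau> \<in> carrier_mat p1 p2" "lmat Qs1 Qs2 \<sigma> \<in> carrier_mat q1 q2"
    by (auto simp: l)
  have X: "X \<in> carrier_mat (p1 + p2) (p1 + p2)" "det X \<noteq> 0"
    unfolding X_def using c by (auto simp: det_four_block_mat_lower_left_zero[of _ p1 _ p2])
  have Y: "Y \<in> carrier_mat (q1 + q2) (q1 + q2)" "det Y \<noteq> 0"
    unfolding Y_def using c by (auto simp: det_four_block_mat_lower_left_zero[of _ q1 _ q2])
  have eq: "X * lmat (Ps1 @ Ps2) (Qs1 @ Qs2) h * Y = dsum (lmat Ps1 Qs1 h) (lmat Ps2 Qs2 h)"
    if low: "\<And>p q. p \<in> set Ps2 \<Longrightarrow> q \<in> set Qs1 \<Longrightarrow> h p q = 0"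
      and h0: "\<And>p q. p \<in> set Ps1 \<Longrightarrow> q \<in> set Qs2 \<Longrightarrow>
        h p q + (\<Sum>k\<in>set Ps2. \<tau> p k * h k q) + (\<Sum>k\<in>set Qs1. h p k * \<sigma> k q) = 0" for h
  proof -
    let ?T = "lmat Ps1 Qs1 h" and ?K = "lmat Ps1 Qs2 h" and ?G = "lmat Ps2 Qs2 h"
    let ?t = "lmat Ps1 Ps2 \<tau>" and ?s = "lmat Qs1 Qs2 \<sigma>"
    have c': "?T \<in> carrier_mat p1 q1" "?K \<in> carrier_mat p1 q2" "?G \<in> carrier_mat p2 q2"
      by (auto simp: l)
    have z: "lmat Ps2 Qs1 h = 0\<^sub>m p2 q1"
      unfolding l lmat_zero[symmetric] using low by (rule lmat_cong)
    have "X * lmat (Ps1 @ Ps2) (Qs1 @ Qs2) h = four_block_mat (1\<^sub>m p1 * ?T + ?t * 0\<^sub>m p2 q1)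
        (1\<^sub>m p1 * ?K + ?t * ?G) (0\<^sub>m p2 p1 * ?T + 1\<^sub>m p2 * 0\<^sub>m p2 q1) (0\<^sub>m p2 p1 * ?K + 1\<^sub>m p2 * ?G)"
      unfolding lmat_append z X_def using c c'
      by (intro mult_four_block_mat) auto
    also have "\<dots> = four_block_mat ?T (?K + ?t * ?G) (0\<^sub>m p2 q1) ?G"
      using c c' by (intro cong_four_block_mat) (auto simp: l[symmetric])
    finally have "X * lmat (Ps1 @ Ps2) (Qs1 @ Qs2) h * Y = four_block_mat (?T * 1\<^sub>m q1 + (?K + ?t * ?G) * 0\<^sub>m q2 q1)
        (?T * ?s + (?K + ?t * ?G) * 1\<^sub>m q2) (0\<^sub>m p2 q1 * 1\<^sub>m q1 + ?G * 0\<^sub>m q2 q1) (0\<^sub>m p2 q1 * ?s + ?G * 1\<^sub>m q2)"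
      unfolding Y_def using c c'
      by (simp only:, intro mult_four_block_mat) auto
    also have "\<dots> = four_block_mat ?T (?T * ?s + (?K + ?t * ?G)) (0\<^sub>m p2 q1) ?G"
      using c c' by (intro cong_four_block_mat) (auto simp: l[symmetric])
    also have "?T * ?s + (?K + ?t * ?G) = 0\<^sub>m p1 q2"
      unfolding lmat_mult[OF dist(1)] lmat_mult[OF dist(2)] lmat_add l lmat_zero[symmetric]
      by (rule lmat_cong) (use h0 in \<open>simp add: add.commute\<close>)
    finally show ?thesis by (simp add: l)
  qed
  have eqf: "X * lmat (Ps1 @ Ps2) (Qs1 @ Qs2) f * Y = dsum (lmat Ps1 Qs1 f) (lmat Ps2 Qs2 f)"
    by (rule eq) (use low f0 in auto)
  have eqg: "X * lmat (Ps1 @ Ps2) (Qs1 @ Qs2) g * Y = dsum (lmat Ps1 Qs1 g) (lmat Ps2 Qs2 g)"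
    by (rule eq) (use low g0 in auto)
  have c': "lmat (Ps1 @ Ps2) (Qs1 @ Qs2) h \<in> carrier_mat (p1 + p2) (q1 + q2)" for h
    using lmat_carrier[of "Ps1 @ Ps2" "Qs1 @ Qs2" h] by (simp add: l)
  have "jk_decomp ((p1 + p2) + (q1 + q2)) (skew_blk (dsum (lmat Ps1 Qs1 f) (lmat Ps2 Qs2 f)))
          (skew_blk (dsum (lmat Ps1 Qs1 g) (lmat Ps2 Qs2 g))) (bs1 @ bs2)"
    unfolding l
    by (rule jk_decomp_skew_blk_dsum[OF lmat_carrier lmat_carrier lmat_carrier lmat_carrier
          t[unfolded pencil_type_def]])
  hence "jk_decomp ((p1 + p2) + (q1 + q2)) (skew_blk (lmat (Ps1 @ Ps2) (Qs1 @ Qs2) f))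
      (skew_blk (lmat (Ps1 @ Ps2) (Qs1 @ Qs2) g)) (bs1 @ bs2)"
    by (intro jk_decomp_skew_blk_equiv[OF c' c' X Y]) (simp only: eqf eqg)
  thus ?thesis unfolding pencil_type_def by (simp add: l)
qed

section \<open>Toeplitz pencils\<close>

unbundle fps_syntax
no_notation vec_index (infixl "$" 100)

definition fps_rows :: "nat \<Rightarrow> (nat \<Rightarrow> complex fps) \<Rightarrow> complex mat" where
  "fps_rows n c = mat n n (\<lambda>(i,j). c i $ j)"

text \<open>Acting from the right on rows of coefficients, this matrix is multiplication by
  \<open>F\<close> in \<open>C[X]/X^n\<close>.\<close>

definition toeplitz :: "nat \<Rightarrow> complex fps \<Rightarrow> complex mat" where
  "toeplitz n F = mat n n (\<lambda>(i,j). if i \<le> j then F $ (j - i) else 0)"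

lemma fps_rows_carrier: "fps_rows n c \<in> carrier_mat n n"
  and toeplitz_carrier: "toeplitz n F \<in> carrier_mat n n"
  by (auto simp: fps_rows_def toeplitz_def)

lemma fps_rows_mult_toeplitz: "fps_rows n c * toeplitz n F = fps_rows n (\<lambda>i. c i * F)"
proof (rule eq_matI)
  fix i j assume "i < dim_row (fps_rows n (\<lambda>i. c i * F))" "j < dim_col (fps_rows n (\<lambda>i. c i * F))"
  hence ij: "i < n" "j < n" by (auto simp: fps_rows_def)
  have "(\<Sum>k = 0..<n. c i $ k * (if k \<le> j then F $ (j - k) else 0)) = (\<Sum>k = 0..j. c i $ k * F $ (j - k))"
    using ij by (intro sum.mono_neutral_cong_right) auto
  thus "(fps_rows n c * toeplitz n F) $$ (i,j) = fps_rows n (\<lambda>i. c i * F) $$ (i,j)"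
    using ij by (simp add: fps_rows_def toeplitz_def scalar_prod_def fps_mult_nth)
qed (auto simp: fps_rows_def toeplitz_def)

lemma inverse_mat_obtain:
  assumes "A \<in> carrier_mat n n" "det A \<noteq> (0 :: complex)"
  obtains B where "B \<in> carrier_mat n n" "A * B = 1\<^sub>m n" "det B \<noteq> 0"
proof -
  from det_non_zero_imp_unit[OF assms, of "()"] obtain B where B: "B \<in> carrier_mat n n" "A * B = 1\<^sub>m n"
    unfolding Units_def ring_mat_def by auto
  have "det A * det B = 1" using det_mult[OF assms(1) B(1)] B by simp
  hence "det B \<noteq> 0" by auto
  with B that show thesis by blast
qed

lemma fps_mult_nth_low:
  fixes a b :: "complex fps"
  assumes "\<And>k. k < i \<Longrightarrow> a $ k = 0"
  shows "j < i \<Longrightarrow> (a * b) $ j = 0" "(a * b) $ i = a $ i * b $ 0"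
proof -
  show "j < i \<Longrightarrow> (a * b) $ j = 0" using assms by (auto simp: fps_mult_nth intro!: sum.neutral)
  have "(\<Sum>k = 0..i. a $ k * b $ (i - k)) = (\<Sum>k \<in> {i}. a $ k * b $ (i - k))"
    using assms by (intro sum.mono_neutral_right) auto
  thus "(a * b) $ i = a $ i * b $ 0" by (simp add: fps_mult_nth)
qed

text \<open>The rows \<open>w^i\<close>, with \<open>w\<close> the nilpotent part of \<open>F / G\<close>, form a Jordan chain.\<close>

lemma jk_decomp_toeplitz:
  assumes n: "n \<ge> 1" and G: "G $ 0 \<noteq> 0" and ev: "\<mu> = F $ 0 / G $ 0"
    and \<Delta>: "n \<ge> 2 \<Longrightarrow> F $ 1 * G $ 0 \<noteq> F $ 0 * G $ 1"
  shows "jk_decomp (n + n) (skew_blk (toeplitz n F)) (skew_blk (toeplitz n G)) [Jordan (Fin \<mu>) n]"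
proof -
  define u where "u = F * inverse G"
  have uG: "u * G = F" using G by (simp add: u_def mult.assoc inverse_mult_eq_1)
  have u0: "u $ 0 = \<mu>" using G uG ev by (metis fps_mult_nth_0 nonzero_mult_div_cancel_right)
  define w where "w = u - fps_const \<mu>"
  have w0: "w $ 0 = 0" using u0 by (simp add: w_def)
  \<comment> \<open>Comparing linear coefficients turns the hypothesis \<open>\<Delta>\<close> into
    a nonzero linear coefficient of \<open>F / G\<close>, so \<open>w\<close> has order exactly one
    if \<open>n \<ge> 2\<close>.\<close>
  have "F $ 1 = u $ 0 * G $ 1 + u $ 1 * G $ 0"
    unfolding uG[symmetric] by (simp add: fps_mult_nth)
  hence w1: "w $ 1 \<noteq> 0" if "n \<ge> 2"
    using \<Delta>[OF that] ev G u0 by (auto simp: w_def field_simps)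
  have wlow: "(w ^ i) $ k = 0" if "k < i" for i k
    using startsby_zero_power_prefix[OF w0] that by blast
  have wdiag: "(w ^ i) $ i = (w $ 1) ^ i" for i
    using startsby_zero_power_nth_same[OF w0] .
  \<comment> \<open>Both matrices are upper triangular with nonzero diagonal, because for
    \<open>i < n\<close> the series \<open>w^i\<close> starts exactly in degree \<open>i\<close> and
    \<open>G\<close> is a unit.\<close>
  define X where "X = fps_rows n (\<lambda>i. w ^ i)"
  define Z where "Z = fps_rows n (\<lambda>i. w ^ i * G)"
  have nz: "(w $ 1) ^ i \<noteq> 0" if "i < n" for i
    using that w1 by (cases i) auto
  have X: "X \<in> carrier_mat n n" and Z: "Z \<in> carrier_mat n n" by (auto simp: X_def Z_def fps_rows_carrier)
  have detnz: "det (fps_rows n c) \<noteq> 0"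
    if "\<And>i j. j < i \<Longrightarrow> c i $ j = 0" "\<And>i. i < n \<Longrightarrow> c i $ i \<noteq> 0" for c
  proof -
    have "upper_triangular (fps_rows n c)" using that by (auto simp: upper_triangular_def fps_rows_def)
    hence "det (fps_rows n c) = prod_list (diag_mat (fps_rows n c))"
      by (rule det_upper_triangular[OF _ fps_rows_carrier])
    moreover have "0 \<notin> set (diag_mat (fps_rows n c))"
      using that(2) by (auto simp: diag_mat_def fps_rows_def)
    ultimately show ?thesis by (simp add: prod_list_zero_iff)
  qed
  have dX: "det X \<noteq> 0" unfolding X_def by (rule detnz) (use wlow wdiag nz in auto)
  have dZ: "det Z \<noteq> 0" unfolding Z_def
  proof (rule detnz)
    show "(w ^ i * G) $ j = 0" if "j < i" for i j using fps_mult_nth_low(1)[of i "w ^ i"] wlow that by auto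
    show "(w ^ i * G) $ i \<noteq> 0" if "i < n" for i
      using fps_mult_nth_low(2)[of i "w ^ i"] wlow wdiag nz[OF that] G by auto
  qed
  \<comment> \<open>With \<open>Y\<close> inverse to \<open>Z\<close>, the pair \<open>X\<close>,
    \<open>Y\<close> carries the matrix of \<open>G\<close> to the identity and, by
    \<open>XF\<close> below, that of \<open>F\<close> to the Jordan block.\<close>
  obtain Y where Y: "Y \<in> carrier_mat n n" "Z * Y = 1\<^sub>m n" "det Y \<noteq> 0"
    using inverse_mat_obtain[OF Z dZ] .
  have XG: "X * toeplitz n G = Z" unfolding X_def Z_def fps_rows_mult_toeplitz ..
  have XF: "X * toeplitz n F = jordan_block n \<mu> * Z"
    unfolding X_def fps_rows_mult_toeplitz
  proof (rule eq_matI)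
    fix i j assume "i < dim_row (jordan_block n \<mu> * Z)" "j < dim_col (jordan_block n \<mu> * Z)"
    hence ij: "i < n" "j < n" using Z by auto
    \<comment> \<open>Hence row \<open>i\<close> of \<open>X\<close> times the matrix of
      \<open>F\<close> is \<open>\<mu>\<close> times row \<open>i\<close> of \<open>Z\<close> plus
      the next row of \<open>Z\<close>.\<close>
    have "F = (fps_const \<mu> + w) * G" using uG by (simp add: w_def)
    hence "w ^ i * F = fps_const \<mu> * (w ^ i * G) + w ^ Suc i * G" by (simp add: algebra_simps)
    hence e: "(w ^ i * F) $ j = \<mu> * (w ^ i * G) $ j + (w ^ Suc i * G) $ j" by simp
    have "(jordan_block n \<mu> * Z) $$ (i,j) =
       (\<Sum>k = 0..<n. (if i = k then \<mu> else if Suc i = k then 1 else 0) * (w ^ k * G) $ j)"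
      using ij by (simp add: scalar_prod_def Z_def fps_rows_def)
    also have "\<dots> = (\<Sum>k = 0..<n. (if i = k then \<mu> * (w ^ k * G) $ j else 0) + (if Suc i = k then (w ^ k * G) $ j else 0))"
      by (intro sum.cong) auto
    also have "\<dots> = \<mu> * (w ^ i * G) $ j + (if Suc i < n then (w ^ Suc i * G) $ j else 0)"
      using ij by (simp add: sum.distrib)
    \<comment> \<open>The last row has no successor, consistently with \<open>w^n * G\<close> having
      no coefficients below degree \<open>n\<close>.\<close>
    also have "(if Suc i < n then (w ^ Suc i * G) $ j else 0) = (w ^ Suc i * G) $ j"
    proof (cases "Suc i < n")
      case False
      hence "(w ^ Suc i * G) $ j = 0"
        using ij by (intro fps_mult_nth_low(1)[where i = "Suc i"] wlow) auto
      with False show ?thesis by simp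
    qed simp
    finally show "fps_rows n (\<lambda>i. w ^ i * F) $$ (i,j) = (jordan_block n \<mu> * Z) $$ (i,j)"
      unfolding e[symmetric] using ij by (simp add: fps_rows_def)
  qed (use Z in \<open>auto simp: fps_rows_def\<close>)
  have J: "jordan_block n \<mu> \<in> carrier_mat n n" by (auto simp: jordan_block_def)
  have XGY: "X * toeplitz n G * Y = 1\<^sub>m n" unfolding XG by (rule Y(2))
  have XFY: "X * toeplitz n F * Y = jordan_block n \<mu>"
    unfolding XF using J Z Y by (simp add: assoc_mult_mat[OF J Z Y(1)])
  have single: "bdiag [M] = M" for M by (auto intro!: eq_matI)
  have c: "skew_blk M \<in> carrier_mat (n + n) (n + n)" if "M \<in> carrier_mat n n" for M
    using skew_blk_carrier[OF that] .
  show ?thesis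
  proof (rule jk_decomp_skew_blk_equiv[OF toeplitz_carrier toeplitz_carrier X dX Y(1,3)])
    show "jk_decomp (n + n) (skew_blk (X * toeplitz n F * Y)) (skew_blk (X * toeplitz n G * Y)) [Jordan (Fin \<mu>) n]"
      unfolding XFY XGY jk_decomp_def using n c[OF J] c[OF one_carrier_mat]
      by (intro conjI exI[of _ "1\<^sub>m (n + n)"]) (simp_all add: single del: bdiag.simps)
  qed
qed

lemma pencil_type_toeplitz:
  assumes "length Ps = n" "length Qs = n" "n \<ge> 1" "G $ 0 \<noteq> 0" "\<mu> = F $ 0 / G $ 0"
    and "n \<ge> 2 \<Longrightarrow> F $ 1 * G $ 0 \<noteq> F $ 0 * G $ 1"
    and "\<And>i j. i < n \<Longrightarrow> j < n \<Longrightarrow> f (Ps ! i) (Qs ! j) = (if i \<le> j then F $ (j - i) else 0)"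
    and "\<And>i j. i < n \<Longrightarrow> j < n \<Longrightarrow> g (Ps ! i) (Qs ! j) = (if i \<le> j then G $ (j - i) else 0)"
  shows "pencil_type Ps Qs f g [Jordan (Fin \<mu>) n]"
proof -
  have "lmat Ps Qs f = toeplitz n F" "lmat Ps Qs g = toeplitz n G"
    using assms by (auto simp: lmat_def toeplitz_def intro!: eq_matI)
  thus ?thesis unfolding pencil_type_def using jk_decomp_toeplitz[of n G \<mu> F] assms by simp
qed

unbundle no fps_syntax
notation vec_index (infixl "$" 100)

section \<open>Semidirect products of abelian Lie algebras\<close>

text \<open>The semidirect product of an abelian algebra with basis \<open>Ps\<close> and an abelian ideal with basis
  \<open>Qs\<close>; \<open>\<rho> p q k\<close> is the coefficient of \<open>k\<close> in \<open>[p, q]\<close>.\<close>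

definition semidirect_struct ::
  "'p list \<Rightarrow> 'q list \<Rightarrow> ('p \<Rightarrow> 'q \<Rightarrow> 'q \<Rightarrow> complex) \<Rightarrow> nat \<Rightarrow> nat \<Rightarrow> nat \<Rightarrow> complex" where
  "semidirect_struct Ps Qs \<rho> i j k =
     (if k < length Ps then 0
      else if i < length Ps \<and> length Ps \<le> j then
        \<rho> (Ps ! i) (Qs ! (j - length Ps)) (Qs ! (k - length Ps))
      else if length Ps \<le> i \<and> j < length Ps then
        - \<rho> (Ps ! j) (Qs ! (i - length Ps)) (Qs ! (k - length Ps))
      else 0)"

lemma sum_nth_distinct:
  "distinct xs \<Longrightarrow> (\<Sum>k<length xs. h (xs ! k)) = (\<Sum>q\<in>set xs. h q)"
  by (rule sum.reindex_bij_betw[OF bij_betw_nth]) auto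

lemma sum_lessThan_shift:
  fixes h :: "nat \<Rightarrow> complex"
  assumes "\<And>k. k < p \<Longrightarrow> h k = 0"
  shows "(\<Sum>k<p + r. h k) = (\<Sum>k<r. h (p + k))"
proof -
  have "(\<Sum>k<p + r. h k) = (\<Sum>k<p. h k) + (\<Sum>k<r. h (p + k))"
    by (induction r) auto
  thus ?thesis using assms by simp
qed

text \<open>All brackets lie in the abelian ideal, so a Jacobi sum is nontrivial only for two
  arguments from \<open>Ps\<close> and one from \<open>Qs\<close>. There it is a commutator of two
  action operators, which \<open>comm\<close> makes vanish.\<close>

lemma lie_algebra_semidirect:
  assumes dist: "distinct Qs"
    and comm: "\<And>p p' q s. p \<in> set Ps \<Longrightarrow> p' \<in> set Ps \<Longrightarrow> q \<in> set Qs \<Longrightarrow> s \<in> set Qs \<Longrightarrow>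
      (\<Sum>k\<in>set Qs. \<rho> p q k * \<rho> p' k s) = (\<Sum>k\<in>set Qs. \<rho> p' q k * \<rho> p k s)"
  shows "lie_algebra (length Ps + length Qs) (semidirect_struct Ps Qs \<rho>)"
proof -
  define p r where "p = length Ps" "r = length Qs"
  note pr = this
  let ?c = "semidirect_struct Ps Qs \<rho>"
  \<comment> \<open>This is the commutator of the actions of the basis vectors \<open>a\<close> and
    \<open>b\<close>, applied to the ideal element \<open>j\<close>.\<close>
  have mixed: "(\<Sum>k<p + r. ?c a j k * ?c k i m - ?c b j k * ?c k l m) = 0"
    if "a < p" "b < p" "i = b" "l = a" "p \<le> j" "j < p + r" "m < p + r" for a b i j l m
  proof (cases "m < p")
    case True
    thus ?thesis by (simp add: semidirect_struct_def pr)
  next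
    case False
    let ?q = "Qs ! (j - p)" and ?s = "Qs ! (m - p)"
    have mem: "Ps ! a \<in> set Ps" "Ps ! b \<in> set Ps" "?q \<in> set Qs" "?s \<in> set Qs"
      using that False by (auto simp: pr)
    have "(\<Sum>k<p + r. ?c a j k * ?c k i m - ?c b j k * ?c k l m)
       = (\<Sum>k<r. ?c a j (p + k) * ?c (p + k) i m - ?c b j (p + k) * ?c (p + k) l m)"
      by (rule sum_lessThan_shift) (simp add: semidirect_struct_def pr)
    also have "\<dots> = (\<Sum>k<r. \<rho> (Ps ! b) ?q (Qs ! k) * \<rho> (Ps ! a) (Qs ! k) ?s
        - \<rho> (Ps ! a) ?q (Qs ! k) * \<rho> (Ps ! b) (Qs ! k) ?s)"
      using that False by (intro sum.cong) (auto simp: semidirect_struct_def pr)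
    also have "\<dots> = 0"
      unfolding sum_subtractf pr(2)
        sum_nth_distinct[OF dist, of "\<lambda>k. \<rho> (Ps ! b) ?q k * \<rho> (Ps ! a) k ?s"]
        sum_nth_distinct[OF dist, of "\<lambda>k. \<rho> (Ps ! a) ?q k * \<rho> (Ps ! b) k ?s"]
      using comm[OF mem(2,1,3,4)] by simp
    finally show ?thesis .
  qed
  have anti: "?c i j k = - ?c j i k" for i j k
    by (auto simp: semidirect_struct_def)
  have PP: "?c i j k = 0" if "i < p" "j < p" for i j k
    using that by (simp add: semidirect_struct_def pr)
  \<comment> \<open>The inner bracket lies in the ideal and therefore commutes with every ideal
    element \<open>l\<close>.\<close>
  have QQ: "?c i j k * ?c k l m = 0" if "p \<le> l" for i j k l m
    using that by (auto simp: semidirect_struct_def pr)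
  have QQ': "?c i j k = 0" if "p \<le> i" "p \<le> j" for i j k
    using that by (simp add: semidirect_struct_def pr)
  have "(\<Sum>k<p + r. ?c i j k * ?c k l m + ?c j l k * ?c k i m + ?c l i k * ?c k j m) = 0"
    if b: "i < p + r" "j < p + r" "l < p + r" "m < p + r" for i j l m
  proof -
    \<comment> \<open>The first three cases put a single ideal element in each of the three
      positions, the fourth has none, and the last three have at least two.\<close>
    consider "i < p" "j < p" "p \<le> l" | "i < p" "p \<le> j" "l < p" | "p \<le> i" "j < p" "l < p"
      | "i < p" "j < p" "l < p" | "p \<le> i" "p \<le> j" | "p \<le> i" "p \<le> l" | "p \<le> j" "p \<le> l"
      by linarith
    thus ?thesis
    proof cases
      case 1
      have "(\<Sum>k<p + r. ?c j l k * ?c k i m - ?c i l k * ?c k j m) = 0"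
        by (rule mixed) (use 1 b in auto)
      thus ?thesis using 1 PP by (simp add: anti[of l i])
    next
      case 2
      have "(\<Sum>k<p + r. ?c i j k * ?c k l m - ?c l j k * ?c k i m) = 0"
        by (rule mixed) (use 2 b in auto)
      thus ?thesis using 2 PP by (simp add: anti[of j l])
    next
      case 3
      have "(\<Sum>k<p + r. ?c l i k * ?c k j m - ?c j i k * ?c k l m) = 0"
        by (rule mixed) (use 3 b in auto)
      thus ?thesis using 3 PP by (simp add: anti[of i j] add.commute)
    next
      case 4
      thus ?thesis using PP by simp
    next
      case 5
      thus ?thesis by (simp add: QQ QQ')
    next
      case 6
      thus ?thesis by (simp add: QQ QQ')
    next
      case 7
      thus ?thesis by (simp add: QQ QQ')
    qed
  qed
  thus ?thesis using anti unfolding lie_algebra_def pr by blast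
qed

section \<open>Forms and invariants of a semidirect product\<close>

definition dual_coord :: "nat \<Rightarrow> 'q list \<Rightarrow> complex vec \<Rightarrow> 'q \<Rightarrow> complex" where
  "dual_coord p Qs x q = x $ (p + (THE k. k < length Qs \<and> Qs ! k = q))"

lemma dual_coord_nth:
  assumes "distinct Qs" "k < length Qs"
  shows "dual_coord p Qs x (Qs ! k) = x $ (p + k)"
proof -
  have "(THE l. l < length Qs \<and> Qs ! l = Qs ! k) = k"
    using assms by (intro the_equality) (auto simp: nth_eq_iff_index_eq)
  thus ?thesis by (simp add: dual_coord_def)
qed

text \<open>Only brackets between \<open>Ps\<close> and \<open>Qs\<close> survive, which leaves one
  off-diagonal block. These brackets lie in the ideal, so the block depends on \<open>x\<close> only
  through its coordinates at \<open>Qs\<close>.\<close>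

lemma lie_form_semidirect:
  assumes dist: "distinct Qs"
  shows "lie_form (length Ps + length Qs) (semidirect_struct Ps Qs \<rho>) x =
     skew_blk (lmat Ps Qs (\<lambda>p q. \<Sum>k\<in>set Qs. dual_coord (length Ps) Qs x k * \<rho> p q k))"
    (is "_ = skew_blk (lmat Ps Qs ?f)")
proof (rule eq_matI)
  let ?p = "length Ps" and ?r = "length Qs" and ?c = "semidirect_struct Ps Qs \<rho>"
  note car = skew_blk_carrier[OF lmat_carrier[of Ps Qs ?f]]
  fix i j assume "i < dim_row (skew_blk (lmat Ps Qs ?f))" "j < dim_col (skew_blk (lmat Ps Qs ?f))"
  hence ij: "i < ?p + ?r" "j < ?p + ?r" using car by auto
  have S: "(\<Sum>k<?p + ?r. x $ k * ?c i j k) = (\<Sum>k<?r. x $ (?p + k) * ?c i j (?p + k))"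
    by (rule sum_lessThan_shift) (simp add: semidirect_struct_def)
  have T: "(\<Sum>k<?r. x $ (?p + k) * \<rho> a b (Qs ! k)) = ?f a b" for a b
    using sum_nth_distinct[OF dist, of "\<lambda>k. dual_coord ?p Qs x k * \<rho> a b k"]
    by (simp add: dual_coord_nth[OF dist])
  consider "i < ?p" "j < ?p" | b where "i < ?p" "b < ?r" "j = ?p + b"
    | a where "a < ?r" "i = ?p + a" "j < ?p" | a b where "a < ?r" "i = ?p + a" "b < ?r" "j = ?p + b"
    using ij by (metis add_less_cancel_left le_Suc_ex not_less)
  hence "(\<Sum>k<?p + ?r. x $ k * ?c i j k) = skew_blk (lmat Ps Qs ?f) $$ (i,j)"
  proof cases
    case 1
    thus ?thesis unfolding S by (simp add: skew_blk_index[OF lmat_carrier] semidirect_struct_def)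
  next
    case 2
    have "(\<Sum>k<?r. x $ (?p + k) * ?c i j (?p + k)) = (\<Sum>k<?r. x $ (?p + k) * \<rho> (Ps ! i) (Qs ! b) (Qs ! k))"
      using 2 by (intro sum.cong) (auto simp: semidirect_struct_def)
    thus ?thesis unfolding S T using 2 by (simp add: skew_blk_index[OF lmat_carrier]) (simp add: lmat_def)
  next
    case 3
    have "(\<Sum>k<?r. x $ (?p + k) * ?c i j (?p + k)) = - (\<Sum>k<?r. x $ (?p + k) * \<rho> (Ps ! j) (Qs ! a) (Qs ! k))"
      unfolding sum_negf[symmetric] using 3 by (intro sum.cong) (auto simp: semidirect_struct_def)
    thus ?thesis unfolding S T using 3 by (simp add: skew_blk_index[OF lmat_carrier]) (simp add: lmat_def)
  next
    case 4
    thus ?thesis unfolding S by (simp add: skew_blk_index[OF lmat_carrier] semidirect_struct_def)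
  qed
  thus "lie_form (?p + ?r) ?c x $$ (i,j) = skew_blk (lmat Ps Qs ?f) $$ (i,j)"
    using ij by (simp add: lie_form_def)
qed (use skew_blk_carrier[OF lmat_carrier[of Ps Qs ?f]] in \<open>auto simp: lie_form_def\<close>)

text \<open>A principal open set serves as the generic set: the nonvanishing locus of one polynomial
  \<open>F\<close>, with \<open>(x0, a0)\<close> witnessing that it is nonempty.\<close>

lemma jk_invariants_semidirect:
  assumes dist: "distinct Qs"
    and F: "poly_fun (length Ps + length Qs) F"
    and pt: "x0 \<in> carrier_vec (length Ps + length Qs)" "a0 \<in> carrier_vec (length Ps + length Qs)" "F (x0, a0) \<noteq> 0"
    and dec: "\<And>x a. x \<in> carrier_vec (length Ps + length Qs) \<Longrightarrow> a \<in> carrier_vec (length Ps + length Qs) \<Longrightarrow>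
      F (x, a) \<noteq> 0 \<Longrightarrow> \<exists>bs. pencil_type Ps Qs
         (\<lambda>p q. \<Sum>k\<in>set Qs. dual_coord (length Ps) Qs x k * \<rho> p q k)
         (\<lambda>p q. \<Sum>k\<in>set Qs. dual_coord (length Ps) Qs a k * \<rho> p q k) bs \<and> jk_data bs = D"
  shows "jk_invariants (length Ps + length Qs) (semidirect_struct Ps Qs \<rho>) D"
proof -
  let ?n = "length Ps + length Qs"
  let ?U = "{p \<in> carrier_vec ?n \<times> carrier_vec ?n. F p \<noteq> 0}"
  have "zariski_open ?n ?U"
    unfolding zariski_open_def using F by (intro exI[of _ "{F}"]) auto
  moreover have "(x0, a0) \<in> ?U" using pt by simp
  moreover have "\<forall>(x,a)\<in>?U. \<exists>bs. jk_decomp ?n (lie_form ?n (semidirect_struct Ps Qs \<rho>) x)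
      (lie_form ?n (semidirect_struct Ps Qs \<rho>) a) bs \<and> jk_data bs = D"
    unfolding lie_form_semidirect[OF dist] using dec unfolding pencil_type_def by auto
  ultimately show ?thesis unfolding jk_invariants_def by blast
qed

section \<open>Polynomial functions and the data of a block list\<close>

lemma poly_fun_diff:
  assumes "poly_fun n f" "poly_fun n g"
  shows "poly_fun n (\<lambda>p. f p - g p)"
proof -
  have "poly_fun n (\<lambda>p. f p + (\<lambda>_. - 1) p * g p)"
    using assms by (intro poly_fun.intros)
  thus ?thesis by simp
qed

lemma poly_fun_prod:
  assumes "finite S" "\<And>s. s \<in> S \<Longrightarrow> poly_fun n (f s)"
  shows "poly_fun n (\<lambda>p. \<Prod>s\<in>S. f s p)"
  using assms
proof (induction S rule: finite_induct)
  case empty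
  show ?case using poly_fun.const[of n 1] by simp
next
  case (insert s S)
  thus ?case using poly_fun.mult[of n "f s" "\<lambda>p. \<Prod>s\<in>S. f s p"] by simp
qed

lemma concat_map_if_distinct:
  "distinct ks \<Longrightarrow> concat (map (\<lambda>k. if k = t then g k else []) ks) = (if t \<in> set ks then g t else [])"
  by (induction ks) auto

text \<open>Injectivity of \<open>\<mu>\<close> keeps different tuples from merging at a common
  eigenvalue, and nonemptiness makes every tuple contribute its eigenvalue.\<close>

lemma jk_data_blocks:
  fixes \<mu> :: "nat \<Rightarrow> complex"
  assumes ne: "\<And>t. t < length N \<Longrightarrow> N ! t \<noteq> []" and inj: "inj_on \<mu> {0..<length N}"
  shows "jk_data (concat (map (\<lambda>t. map (Jordan (Fin (\<mu> t))) (N ! t)) [0..<length N]) @ replicate q (Kron 1))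
    = (replicate_mset q 1, mset (map mset N))"
proof -
  let ?J = "\<lambda>t. map (Jordan (Fin (\<mu> t))) (N ! t)"
  let ?bs = "concat (map ?J [0..<length N]) @ replicate q (Kron 1)"
  have K: "concat (map kron_size (map (Jordan \<nu>) ms)) = []" for \<nu> ms
    by (induction ms) auto
  have K': "concat (map kron_size (concat (map ?J ts))) = []" for ts
    by (induction ts) (auto simp: K[simplified])
  have R: "concat (map kron_size (replicate q (Kron 1))) = replicate q 1"
    by (induction q) auto
  have 1: "concat (map kron_size ?bs) = replicate q 1"
    by (simp only: map_append concat_append K' R append_Nil)
  have E: "(\<Union>b\<in>set ?bs. block_eig b) = (\<lambda>t. Fin (\<mu> t)) ` {0..<length N}"
  proof (intro equalityI subsetI)
    fix e assume "e \<in> (\<lambda>t. Fin (\<mu> t)) ` {0..<length N}"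
    then obtain t where t: "t < length N" "e = Fin (\<mu> t)" by auto
    obtain m where "m \<in> set (N ! t)" using ne[OF t(1)] by (cases "N ! t") auto
    hence "Jordan (Fin (\<mu> t)) m \<in> set ?bs" using t by auto
    thus "e \<in> (\<Union>b\<in>set ?bs. block_eig b)"
      using t by (intro UN_I[of "Jordan (Fin (\<mu> t)) m"]) auto
  qed auto
  have J: "concat (map (jordan_size_at \<nu>) (map (Jordan \<nu>') ms)) = (if \<nu>' = \<nu> then ms else [])" for \<nu> \<nu>' ms
    by (induction ms) auto
  have J': "concat (map (jordan_size_at (Fin (\<mu> t))) (concat (map ?J ts)))
      = concat (map (\<lambda>s. if s = t then N ! s else []) ts)"
    if "t < length N" "set ts \<subseteq> {0..<length N}" for t ts
    using that(2)
  proof (induction ts)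
    case (Cons s ts)
    have "\<mu> s = \<mu> t \<longleftrightarrow> s = t" using that(1) Cons.prems inj by (auto simp: inj_on_def)
    thus ?case using Cons by (simp add: J[simplified])
  qed simp
  have R': "concat (map (jordan_size_at \<nu>) (replicate q (Kron 1))) = []" for \<nu>
    by (induction q) auto
  have 2: "mset (concat (map (jordan_size_at (Fin (\<mu> t))) ?bs)) = mset (N ! t)" if "t < length N" for t
    using that by (simp only: map_append concat_append R' append_Nil2 J'[OF that] set_upt subset_refl
        concat_map_if_distinct distinct_upt) simp
  have inj': "inj_on (\<lambda>t. Fin (\<mu> t)) {0..<length N}" using inj by (auto simp: inj_on_def)
  have "image_mset (\<lambda>\<nu>. mset (concat (map (jordan_size_at \<nu>) ?bs))) (mset_set (\<Union>b\<in>set ?bs. block_eig b))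
     = image_mset (\<lambda>t. mset (concat (map (jordan_size_at (Fin (\<mu> t))) ?bs))) (mset_set {0..<length N})"
    unfolding E image_mset_mset_set[OF inj', symmetric] by (simp add: multiset.map_comp comp_def)
  also have "\<dots> = image_mset (\<lambda>t. mset (N ! t)) (mset_set {0..<length N})"
    by (intro image_mset_cong 2) auto
  also have "\<dots> = mset (map (\<lambda>t. mset (N ! t)) [0..<length N])"
    by simp
  also have "map (\<lambda>t. mset (N ! t)) [0..<length N] = map mset N"
    by (rule nth_equalityI) auto
  finally show ?thesis unfolding jk_data_def 1 by simp
qed

section \<open>Two or more trivial Kronecker blocks\<close>

text \<open>A label \<open>(t, m, i)\<close> stands for the \<open>i\<close>-th basis vector belonging to the \<open>m\<close>-th Jordan block of
  the \<open>t\<close>-th tuple; \<open>m = 0\<close> is the largest block of the tuple.\<close>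

type_synonym label = "nat \<times> nat \<times> nat"

definition block_labels :: "nat \<Rightarrow> nat list \<Rightarrow> label list" where
  "block_labels t ns = concat (map (\<lambda>m. map (\<lambda>i. (t, m, i)) [0..<ns ! m]) [0..<length ns])"

lemma distinct_concat_map:
  assumes "distinct ks" "\<And>k. k \<in> set ks \<Longrightarrow> distinct (f k)"
    and "\<And>k k'. k \<in> set ks \<Longrightarrow> k' \<in> set ks \<Longrightarrow> k \<noteq> k' \<Longrightarrow> set (f k) \<inter> set (f k') = {}"
  shows "distinct (concat (map f ks))"
  using assms
proof (induction ks)
  case (Cons k ks)
  have "set (f k) \<inter> set (concat (map f ks)) = {}"
    using Cons.prems(1) Cons.prems(3)[of k] by auto
  thus ?case using Cons by simp
qed simp

lemma concat_map_singleton: "concat (map (\<lambda>k. [h k]) ks) = map h ks"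
  by (induction ks) auto

lemma map_nth_upt: "map (\<lambda>m. h (ns ! m)) [0..<length ns] = map h ns"
  by (rule nth_equalityI) auto

lemma set_block_labels: "(s, m, i) \<in> set (block_labels t ns) \<longleftrightarrow> s = t \<and> m < length ns \<and> i < ns ! m"
  by (fastforce simp: block_labels_def)

lemma distinct_block_labels: "distinct (block_labels t ns)"
  unfolding block_labels_def by (rule distinct_concat_map) (auto simp: distinct_map inj_on_def)

lemma distinct_all_block_labels: "distinct (concat (map (\<lambda>t. block_labels t (N ! t)) [0..<L]))"
  by (rule distinct_concat_map) (auto simp: distinct_block_labels set_block_labels)

text \<open>The central elements \<open>(L, 0, 0)\<close> and \<open>(L, 0, 1)\<close> carry the Jordan matrix with eigenvalue \<open>t\<close> on
  the \<open>t\<close>-th tuple, respectively the identity matrix.\<close>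

fun two_step_action :: "nat \<Rightarrow> label \<Rightarrow> label \<Rightarrow> label \<Rightarrow> complex" where
  "two_step_action L (t, m, i) (t', m', j) (s, r, k) =
     (if t = t' \<and> m = m' \<and> s = L \<and> r = 0 then
        (if k = 0 then (if i = j then of_nat t else if j = Suc i then 1 else 0)
         else if k = 1 \<and> i = j then 1 else 0)
      else 0)"

text \<open>All brackets are central, so products of action operators vanish and commutativity is
  immediate. On each block the form of \<open>x\<close> is a combination of a Jordan block and the
  identity; each of the \<open>q\<close> central labels pairs to zero with all rows and gives a
  Kronecker block.\<close>

lemma jk_realization_two_central:
  fixes N :: "nat list list"
  assumes ne: "\<And>t. t < length N \<Longrightarrow> N ! t \<noteq> []"
    and pos: "\<And>t m. t < length N \<Longrightarrow> m < length (N ! t) \<Longrightarrow> N ! t ! m \<ge> 1"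
    and q: "q \<ge> 2"
  shows "\<exists>n c. lie_algebra n c \<and> jk_invariants n c (replicate_mset q 1, mset (map mset N))"
proof -
  define L where "L = length N"
  \<comment> \<open>Tuple indices stay below \<open>L\<close>, so the labels
    \<open>(L, 0, k)\<close> are free for the central elements.\<close>
  define Ps where "Ps = concat (map (\<lambda>t. block_labels t (N ! t)) [0..<L])"
  define Z where "Z = map (\<lambda>k. (L, 0::nat, k)) [0..<q]"
  define Qs where "Qs = Ps @ Z"
  define \<rho> where "\<rho> = two_step_action L"
  define n where "n = length Ps + length Qs"
  \<comment> \<open>Position of the coordinate at \<open>(L, 0, 0)\<close>: it follows the acting
    basis \<open>Ps\<close> and the copy of \<open>Ps\<close> that begins the ideal.\<close>
  define c where "c = length Ps + length Ps"
  have n: "n = c + q" by (simp add: n_def c_def Qs_def Z_def)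
  have Ps: "(t, m, i) \<in> set Ps \<longleftrightarrow> t < L \<and> m < length (N ! t) \<and> i < N ! t ! m" for t m i
    by (auto simp: Ps_def set_block_labels)
  have Zs: "(t, m, i) \<in> set Z \<longleftrightarrow> t = L \<and> m = 0 \<and> i < q" for t m i
    by (auto simp: Z_def)
  have dist: "distinct Qs"
    unfolding Qs_def
    by (auto simp: Ps_def distinct_all_block_labels Z_def distinct_map inj_on_def set_block_labels)
  have z: "\<rho> p k s = 0" if "p \<in> set Ps" "fst k = L" for p k s
    by (cases p; cases k; cases s; use that in \<open>auto simp: \<rho>_def Ps\<close>)
  have z': "\<rho> p k s = 0" if "fst s \<noteq> L" for p k s
    by (cases p; cases k; cases s; use that in \<open>auto simp: \<rho>_def\<close>)
  have comm: "(\<Sum>k\<in>set Qs. \<rho> p v k * \<rho> p' k s) = 0" if "p' \<in> set Ps" for p p' v s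
    using that z z' by (intro sum.neutral ballI) (metis mult_eq_0_iff)
  have lie: "lie_algebra n (semidirect_struct Ps Qs \<rho>)"
    unfolding n_def using dist by (rule lie_algebra_semidirect) (simp add: comm)
  let ?xl = "\<lambda>x. dual_coord (length Ps) Qs x"
  have coord: "?xl x (L, 0, k) = x $ (c + k)" if "k < q" for x k
  proof -
    have "Qs ! (length Ps + k) = (L, 0, k)" "length Ps + k < length Qs"
      using that by (auto simp: Qs_def Z_def nth_append)
    thus ?thesis using dual_coord_nth[OF dist, of "length Ps + k" "length Ps" x]
      by (simp add: c_def add.assoc)
  qed
  have form: "(\<Sum>k\<in>set Qs. ?xl x k * \<rho> (t, m, i) (t', m', j) k) =
      (if t = t' \<and> m = m' then
         (if i = j then x $ c * of_nat t + x $ (c + 1) else if j = Suc i then x $ c else 0) else 0)"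
    for x t m i t' m' j
  proof -
    have "(\<Sum>k\<in>set Qs. ?xl x k * \<rho> (t, m, i) (t', m', j) k) =
        (\<Sum>k\<in>{(L,0,0), (L,0,1)}. ?xl x k * \<rho> (t, m, i) (t', m', j) k)"
    proof (rule sum.mono_neutral_right)
      show "{(L,0,0), (L,0,1)} \<subseteq> set Qs" using q by (auto simp: Qs_def Zs)
      show "\<forall>k\<in>set Qs - {(L,0,0), (L,0,1)}. ?xl x k * \<rho> (t, m, i) (t', m', j) k = 0"
        by (auto simp: \<rho>_def split: if_splits)
    qed auto
    thus ?thesis using coord[of 0 x] coord[of 1 x] q by (simp add: \<rho>_def)
  qed
  \<comment> \<open>The first factor makes \<open>x\<close> and \<open>a\<close> independent on the
    two central labels that occur in brackets; the others are the denominators of the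
    eigenvalues.\<close>
  define F where "F = (\<lambda>p :: complex vec \<times> complex vec.
     (fst p $ c * snd p $ (c + 1) - fst p $ (c + 1) * snd p $ c) *
     (\<Prod>t\<in>{0..<L}. snd p $ c * of_nat t + snd p $ (c + 1)))"
  have lt: "c < n" "c + 1 < n" using q by (auto simp: n)
  have polyF: "poly_fun n F"
    unfolding F_def using lt
    by (intro poly_fun.mult poly_fun.add poly_fun_diff poly_fun_prod poly_fun.intros) auto
  have "jk_invariants n (semidirect_struct Ps Qs \<rho>) (replicate_mset q 1, mset (map mset N))"
  proof (rule jk_invariants_semidirect[OF dist polyF[unfolded n_def], folded n_def])
    \<comment> \<open>At this point every factor of \<open>F\<close> equals 1.\<close>
    show "F (unit_vec n c, unit_vec n (c + 1)) \<noteq> 0"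
      using lt by (simp add: F_def)
  next
    fix x a :: "complex vec"
    assume "F (x, a) \<noteq> 0"
    hence det: "x $ c * a $ (c + 1) \<noteq> x $ (c + 1) * a $ c"
      and nz: "\<And>t. t < L \<Longrightarrow> a $ c * of_nat t + a $ (c + 1) \<noteq> 0"
      by (auto simp: F_def)
    define f where "f = (\<lambda>p v. \<Sum>k\<in>set Qs. ?xl x k * \<rho> p v k)"
    define g where "g = (\<lambda>p v. \<Sum>k\<in>set Qs. ?xl a k * \<rho> p v k)"
    define \<mu> where "\<mu> t = (x $ c * of_nat t + x $ (c + 1)) / (a $ c * of_nat t + a $ (c + 1))" for t :: nat
    have inj: "inj_on \<mu> {0..<L}"
    proof (rule inj_onI)
      fix s t assume st: "s \<in> {0..<L}" "t \<in> {0..<L}" "\<mu> s = \<mu> t"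
      hence "(x $ c * of_nat s + x $ (c + 1)) * (a $ c * of_nat t + a $ (c + 1)) =
          (x $ c * of_nat t + x $ (c + 1)) * (a $ c * of_nat s + a $ (c + 1))"
        using nz[of s] nz[of t] by (simp add: \<mu>_def frac_eq_eq)
      \<comment> \<open>The eigenvalue \<open>\<mu> t\<close> is a Moebius transform of
        \<open>t\<close> with this determinant, hence injective where the denominators do not
        vanish.\<close>
      hence "(x $ c * a $ (c + 1) - x $ (c + 1) * a $ c) * (of_nat s - of_nat t) = 0"
        by (simp add: algebra_simps)
      thus "s = t" using det by simp
    qed
    have blk: "pencil_type (block_labels t (N ! t)) (block_labels t (N ! t)) f g
        (map (Jordan (Fin (\<mu> t))) (N ! t))" if t: "t < L" for t
    proof -
      let ?B = "\<lambda>m. map (\<lambda>i. (t, m, i)) [0..<N ! t ! m]"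
      have "pencil_type (concat (map ?B [0..<length (N ! t)])) (concat (map ?B [0..<length (N ! t)])) f g
          (concat (map (\<lambda>m. [Jordan (Fin (\<mu> t)) (N ! t ! m)]) [0..<length (N ! t)]))"
      proof (rule pencil_type_concat)
        fix m assume m: "m \<in> set [0..<length (N ! t)]"
        let ?F = "\<lambda>y :: complex vec. fps_const (y $ c * of_nat t + y $ (c + 1)) + fps_const (y $ c) * fps_X"
        have co: "fps_nth (?F y) l = (if l = 0 then y $ c * of_nat t + y $ (c + 1) else if l = 1 then y $ c else 0)"
          for y l by (cases l) (auto simp: fps_X_nth)
        show "pencil_type (?B m) (?B m) f g [Jordan (Fin (\<mu> t)) (N ! t ! m)]"
        proof (rule pencil_type_toeplitz[where F = "?F x" and G = "?F a"])
          show "N ! t ! m \<ge> 1" using pos[of t m] t m by (simp add: L_def)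
          show "fps_nth (?F a) 0 \<noteq> 0" using nz[OF t] by (simp only: co) simp
          show "\<mu> t = fps_nth (?F x) 0 / fps_nth (?F a) 0" by (simp only: co \<mu>_def) simp
          \<comment> \<open>The multiples of \<open>t\<close> cancel, so the same determinant
            decides the condition for every tuple.\<close>
          show "fps_nth (?F x) 1 * fps_nth (?F a) 0 \<noteq> fps_nth (?F x) 0 * fps_nth (?F a) 1"
            using det unfolding co by (auto simp: algebra_simps)
        next
          fix i j assume "i < N ! t ! m" "j < N ! t ! m"
          thus "f (?B m ! i) (?B m ! j) = (if i \<le> j then fps_nth (?F x) (j - i) else 0)"
            and "g (?B m ! i) (?B m ! j) = (if i \<le> j then fps_nth (?F a) (j - i) else 0)"
            unfolding co by (auto simp: f_def g_def form)
        qed auto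
      qed (auto simp: f_def g_def form)
      thus ?thesis by (simp add: block_labels_def concat_map_singleton map_nth_upt)
    qed
    have main: "pencil_type Ps Ps f g (concat (map (\<lambda>t. map (Jordan (Fin (\<mu> t))) (N ! t)) [0..<L]))"
      unfolding Ps_def
    proof (rule pencil_type_concat)
      fix k p v k' assume "k \<noteq> k'" "p \<in> set (block_labels k (N ! k))" "v \<in> set (block_labels k' (N ! k'))"
      then show "f p v = 0 \<and> g p v = 0"
        by - (cases p; cases v; auto simp: set_block_labels f_def g_def form)
    qed (use blk in auto)
    have "pencil_type (Ps @ []) (Ps @ Z) f g
        (concat (map (\<lambda>t. map (Jordan (Fin (\<mu> t))) (N ! t)) [0..<L]) @ replicate (length Z) (Kron 1))"
    proof (rule pencil_type_append[OF _ _ main pencil_type_Kron1])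
      fix p v assume "p \<in> set Ps" "v \<in> set Z"
      then show "f p v = 0 \<and> g p v = 0"
        by - (cases p; cases v; auto simp: f_def g_def form Ps Zs)
    qed auto
    hence "pencil_type Ps Qs f g (concat (map (\<lambda>t. map (Jordan (Fin (\<mu> t))) (N ! t)) [0..<L]) @ replicate q (Kron 1))"
      by (simp add: Qs_def Z_def)
    thus "\<exists>bs. pencil_type Ps Qs (\<lambda>p v. \<Sum>k\<in>set Qs. ?xl x k * \<rho> p v k)
        (\<lambda>p v. \<Sum>k\<in>set Qs. ?xl a k * \<rho> p v k) bs \<and> jk_data bs = (replicate_mset q 1, mset (map mset N))"
      using jk_data_blocks[OF ne inj[unfolded L_def], of q] unfolding f_def g_def L_def by blast
  qed auto
  with lie show ?thesis by blast
qed

section \<open>One trivial Kronecker block\<close>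

unbundle fps_syntax
no_notation vec_index (infixl "$" 100)

section \<open>Shears that uncouple the blocks of a tuple\<close>

text \<open>With \<open>e = 1 - \<delta>\<close> and \<open>\<delta> \<le> 1\<close>, row
  \<open>i\<close> holds the coefficients of \<open>A X^e\<close> times the derivative of
  \<open>X^i\<close>.\<close>

definition row_shear :: "nat \<Rightarrow> complex fps \<Rightarrow> nat \<Rightarrow> nat \<Rightarrow> complex" where
  "row_shear \<delta> A i k = (if i \<le> k + \<delta> then A $ (k + \<delta> - i) * of_nat i else 0)"

text \<open>Multiplication by \<open>X^e B\<close> minus the operator \<open>A X^e d/dX\<close> of
  the row shear, again acting on rows of coefficients.\<close>

definition col_shear :: "nat \<Rightarrow> nat \<Rightarrow> complex fps \<Rightarrow> complex fps \<Rightarrow> nat \<Rightarrow> nat \<Rightarrow> complex" where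
  "col_shear \<delta> e A B k j = (if k + e \<le> j then B $ (j - e - k) else 0)
     - (if k \<le> j + \<delta> then A $ (j + \<delta> - k) * of_nat k else 0)"

text \<open>The commutator of multiplication by \<open>h\<close> with \<open>A\<close> times the Euler operator is \<open>A X h'\<close>,
  up to the shift by \<open>\<delta> = 1 - e\<close>.\<close>

lemma shear_identity:
  fixes A B h K :: "complex fps"
  assumes e: "\<delta> + e = 1" and sz: "m + \<delta> \<le> n" and j: "j < m"
    and eq: "A * fps_deriv h - B * h = K"
  shows "(if i + e \<le> j then K $ (j - i - e) else 0)
     + (\<Sum>k<m. row_shear \<delta> A i k * (if k \<le> j then h $ (j - k) else 0))
     + (\<Sum>k<n. (if i \<le> k then h $ (k - i) else 0) * col_shear \<delta> e A B k j) = 0"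
proof (cases "i \<le> j + \<delta>")
  case False
  have "(\<Sum>k<m. row_shear \<delta> A i k * (if k \<le> j then h $ (j - k) else 0)) = 0"
    using False by (intro sum.neutral) (auto simp: row_shear_def)
  moreover have "(\<Sum>k<n. (if i \<le> k then h $ (k - i) else 0) * col_shear \<delta> e A B k j) = 0"
    using False by (intro sum.neutral) (auto simp: col_shear_def)
  ultimately show ?thesis using False by simp
next
  case True
  define s where "s = j + \<delta> - i"
  have 1: "(\<Sum>k<m. row_shear \<delta> A i k * (if k \<le> j then h $ (j - k) else 0))
      = (\<Sum>l = 0..s. of_nat i * (h $ l * A $ (s - l)))"
  \<comment> \<open>For \<open>i = 0\<close> the lower limit \<open>i - \<delta>\<close> used below
    may be truncated at 0; there the factor \<open>of_nat i\<close> kills the sum.\<close>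
  proof (cases "i = 0")
    case True
    thus ?thesis by (simp add: row_shear_def)
  next
    case False
    have "(\<Sum>k<m. row_shear \<delta> A i k * (if k \<le> j then h $ (j - k) else 0))
       = (\<Sum>k = i - \<delta>..j. row_shear \<delta> A i k * h $ (j - k))"
      using j by (intro sum.mono_neutral_cong_right) (auto simp: row_shear_def)
    also have "\<dots> = (\<Sum>l = 0..s. of_nat i * (h $ l * A $ (s - l)))"
      using e False True
      by (intro sum.reindex_bij_witness[where i = "\<lambda>l. j - l" and j = "\<lambda>k. j - k"])
        (auto simp: row_shear_def s_def add.commute)
    finally show ?thesis .
  qed
  \<comment> \<open>Since \<open>j < m\<close>, the bound \<open>m + \<delta> \<le> n\<close> gives
    \<open>j + \<delta> < n\<close>, so the sum contains the whole convolution.\<close>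
  have 2: "(\<Sum>k<n. (if i \<le> k then h $ (k - i) else 0) * (if k \<le> j + \<delta> then A $ (j + \<delta> - k) * of_nat k else 0))
      = (\<Sum>l = 0..s. of_nat (i + l) * (h $ l * A $ (s - l)))"
  proof -
    have "(\<Sum>k<n. (if i \<le> k then h $ (k - i) else 0) * (if k \<le> j + \<delta> then A $ (j + \<delta> - k) * of_nat k else 0))
       = (\<Sum>k = i..j + \<delta>. h $ (k - i) * (A $ (j + \<delta> - k) * of_nat k))"
      using j sz by (intro sum.mono_neutral_cong_right) auto
    also have "\<dots> = (\<Sum>l = 0..s. of_nat (i + l) * (h $ l * A $ (s - l)))"
      using True
      by (intro sum.reindex_bij_witness[where i = "\<lambda>l. l + i" and j = "\<lambda>k. k - i"])
        (auto simp: s_def)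
    finally show ?thesis .
  qed
  have 3: "(\<Sum>k<n. (if i \<le> k then h $ (k - i) else 0) * (if k + e \<le> j then B $ (j - e - k) else 0))
      = (if i + e \<le> j then (h * B) $ (j - i - e) else 0)"
  proof (cases "i + e \<le> j")
    case True
    have "(\<Sum>k<n. (if i \<le> k then h $ (k - i) else 0) * (if k + e \<le> j then B $ (j - e - k) else 0))
       = (\<Sum>k = i..j - e. h $ (k - i) * B $ (j - e - k))"
      using j sz True by (intro sum.mono_neutral_cong_right) auto
    also have "\<dots> = (\<Sum>l = 0..j - i - e. h $ l * B $ (j - i - e - l))"
      using True
      by (intro sum.reindex_bij_witness[where i = "\<lambda>l. l + i" and j = "\<lambda>k. k - i"]) auto
    finally show ?thesis using True by (simp add: fps_mult_nth)
  next
    case False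
    have "(\<Sum>k<n. (if i \<le> k then h $ (k - i) else 0) * (if k + e \<le> j then B $ (j - e - k) else 0)) = 0"
      using False by (intro sum.neutral) auto
    thus ?thesis using False by simp
  qed
  have 4: "(\<Sum>l = 0..s. of_nat l * (h $ l * A $ (s - l))) =
      (if i + e \<le> j then (fps_deriv h * A) $ (j - i - e) else 0)"
  proof (cases "i + e \<le> j")
    case T: True
    have s: "s = Suc (j - i - e)" using e T by (auto simp: s_def)
    have "(\<Sum>l = 0..s. of_nat l * (h $ l * A $ (s - l))) =
       (\<Sum>l = 0..j - i - e. of_nat (Suc l) * (h $ Suc l * A $ (j - i - e - l)))"
      unfolding s sum.atLeast0_atMost_Suc_shift by simp
    also have "\<dots> = (fps_deriv h * A) $ (j - i - e)"
      unfolding fps_mult_nth by (intro sum.cong) (auto simp: algebra_simps)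
    finally show ?thesis using T by simp
  next
    case F: False
    hence "s = 0" using e True by (auto simp: s_def)
    thus ?thesis using F by simp
  qed
  have "(\<Sum>k<n. (if i \<le> k then h $ (k - i) else 0) * col_shear \<delta> e A B k j) =
     (if i + e \<le> j then (h * B) $ (j - i - e) else 0) - (\<Sum>l = 0..s. of_nat (i + l) * (h $ l * A $ (s - l)))"
    unfolding 2[symmetric] 3[symmetric] sum_subtractf[symmetric] col_shear_def
    by (simp only: right_diff_distrib)
  \<comment> \<open>This is the Leibniz rule: the part with \<open>i\<close> cancels the row shear,
    and the part with \<open>l\<close> produces the derivative of \<open>h\<close>.\<close>
  also have "(\<Sum>l = 0..s. of_nat (i + l) * (h $ l * A $ (s - l))) =
     (\<Sum>l = 0..s. of_nat i * (h $ l * A $ (s - l))) + (\<Sum>l = 0..s. of_nat l * (h $ l * A $ (s - l)))"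
    unfolding sum.distrib[symmetric] by (simp only: of_nat_add distrib_right)
  finally have 5: "(\<Sum>k<n. (if i \<le> k then h $ (k - i) else 0) * col_shear \<delta> e A B k j) =
     (if i + e \<le> j then (h * B) $ (j - i - e) else 0) - ((\<Sum>l = 0..s. of_nat i * (h $ l * A $ (s - l))) +
     (if i + e \<le> j then (fps_deriv h * A) $ (j - i - e) else 0))"
    unfolding 4 .
  have "K + h * B - fps_deriv h * A = 0" unfolding eq[symmetric] by (simp add: algebra_simps)
  hence "(K + h * B - fps_deriv h * A) $ (j - i - e) = 0" by simp
  hence "K $ (j - i - e) = (fps_deriv h * A) $ (j - i - e) - (h * B) $ (j - i - e)"
    by (simp add: algebra_simps)
  thus ?thesis unfolding 1 5 by simp
qed

text \<open>Cramer's rule over power series: the determinant is a unit because its constant term is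
  nonzero. \<open>B\<close> is read off from the second equation, which needs \<open>h'\<close> to
  be a unit. Primes mark the second equation, not derivatives.\<close>

lemma fps_cramer:
  fixes h h' d d' k k' :: "complex fps"
  assumes "h' $ 0 \<noteq> 0" and "d $ 0 * h' $ 0 \<noteq> d' $ 0 * h $ 0"
  obtains A B where "A * d - B * h = k" "A * d' - B * h' = k'"
proof -
  define \<Delta> where "\<Delta> = d * h' - d' * h"
  define A where "A = (k * h' - k' * h) * inverse \<Delta>"
  define B where "B = (A * d' - k') * inverse h'"
  have "\<Delta> $ 0 \<noteq> 0" using assms(2) by (simp add: \<Delta>_def)
  hence A: "A * \<Delta> = k * h' - k' * h" by (simp add: A_def mult.assoc inverse_mult_eq_1)
  have B: "B * h' = A * d' - k'" using assms(1) by (simp add: B_def mult.assoc inverse_mult_eq_1)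
  have "(A * d - B * h) * h' = A * (d * h') - (B * h') * h" by (simp add: algebra_simps)
  also have "\<dots> = A * \<Delta> + k' * h" unfolding B \<Delta>_def by (simp add: algebra_simps)
  also have "\<dots> = k * h'" unfolding A by simp
  finally have "A * d - B * h = k" using assms(1) by auto
  moreover have "A * d' - B * h' = k'" unfolding B by simp
  ultimately show thesis by (rule that)
qed

text \<open>For \<open>m > 0\<close> the row label \<open>(t, m, i)\<close> is \<open>X^i\<close> in a second copy of the module, pairing block \<open>m\<close>
  into block \<open>0\<close>. With \<open>e t = 1\<close> the row labels \<open>(t, 0, i)\<close> act by \<open>X^(i + 1)\<close>, which makes
  \<open>(t, 0, 0)\<close> central.\<close>

fun shift_action :: "(nat \<Rightarrow> nat) \<Rightarrow> label \<Rightarrow> label \<Rightarrow> label option" where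
  "shift_action e (t, m, i) (t', m', j) =
     (if t \<noteq> t' then None
      else if m = 0 then (if i + e t \<le> j then Some (t, m', j - i - e t) else None)
      else if m = m' \<and> i \<le> j then Some (t, 0, j - i) else None)"

definition eval_action :: "(nat \<Rightarrow> nat) \<Rightarrow> (label \<Rightarrow> complex) \<Rightarrow> label \<Rightarrow> label \<Rightarrow> complex" where
  "eval_action e y p q = (case shift_action e p q of None \<Rightarrow> 0 | Some k \<Rightarrow> y k)"

text \<open>A defined composite lowers the last index by the sum of both shifts, whatever the order.
  Two row labels with \<open>m > 0\<close> never compose, since the first one lands in block
  0.\<close>

lemma shift_action_commute:
  "Option.bind (shift_action e p q) (shift_action e p') = Option.bind (shift_action e p' q) (shift_action e p)"
proof -
  obtain t m i where p: "p = (t, m, i)" by (cases p)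
  obtain t' m' i' where p': "p' = (t', m', i')" by (cases p')
  obtain s r j where q: "q = (s, r, j)" by (cases q)
  show ?thesis
  proof (cases "t = s \<and> t' = s")
    case True
    thus ?thesis unfolding p p' q
      by (cases "m = 0"; cases "m' = 0") (auto simp: add.commute)
  qed (auto simp: p p' q)
qed

text \<open>Multiplication by \<open>X\<close> lowers the last index, so \<open>(t, 0, 0)\<close> is
  the socle of block 0. If \<open>e t = 1\<close>, block 0 has one more basis vector than rows, and
  the indices start at 1 to set this central label aside.\<close>

definition column_labels :: "(nat \<Rightarrow> nat) \<Rightarrow> nat \<Rightarrow> nat list \<Rightarrow> label list" where
  "column_labels e t ns =
     concat (map (\<lambda>m. map (\<lambda>j. (t, m, if m = 0 then j + e t else j)) [0..<ns ! m]) [0..<length ns])"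

lemma set_column_labels: "(s, m, j) \<in> set (column_labels e t ns) \<longleftrightarrow>
    s = t \<and> m < length ns \<and> (if m = 0 then e t \<le> j \<and> j < ns ! m + e t else j < ns ! m)"
proof
  assume "s = t \<and> m < length ns \<and> (if m = 0 then e t \<le> j \<and> j < ns ! m + e t else j < ns ! m)"
  thus "(s, m, j) \<in> set (column_labels e t ns)"
    unfolding column_labels_def
    by (auto intro!: bexI[of _ m] image_eqI[of _ _ "if m = 0 then j - e t else j"] split: if_splits)
qed (auto simp: column_labels_def split: if_splits)

lemma distinct_column_labels: "distinct (column_labels e t ns)"
  unfolding column_labels_def by (rule distinct_concat_map) (auto simp: distinct_map inj_on_def)

section \<open>The pencil of a single tuple\<close>

lemma sum_block_support:
  assumes "\<And>k. k < n \<Longrightarrow> \<iota> k \<in> S" "finite S" "inj_on \<iota> {..<n}"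
    and "\<And>x. x \<in> S \<Longrightarrow> x \<notin> \<iota> ` {..<n} \<Longrightarrow> h x = (0 :: complex)"
  shows "(\<Sum>x\<in>S. h x) = (\<Sum>k<n. h (\<iota> k))"
proof -
  have "(\<Sum>x\<in>S. h x) = (\<Sum>x\<in>\<iota> ` {..<n}. h x)"
    using assms by (intro sum.mono_neutral_right) auto
  also have "\<dots> = (\<Sum>k<n. h (\<iota> k))"
    using sum.reindex[OF assms(3), of h] by simp
  finally show ?thesis .
qed

text \<open>Every diagonal block is a Toeplitz matrix of the same series, the coordinates at block
  0, so all blocks share the ratio of constant terms as eigenvalue. The rows of block 0 also couple
  to the other columns; a shear clears this, and \<open>dom\<close> is its size condition.\<close>

lemma pencil_type_tuple:
  fixes x a :: "label \<Rightarrow> complex"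
  assumes ns: "ns \<noteq> []" "\<And>m. m < length ns \<Longrightarrow> ns ! m \<ge> 1"
    and e: "e t \<le> 1" and dom: "\<And>m. 1 \<le> m \<Longrightarrow> m < length ns \<Longrightarrow> ns ! m + (1 - e t) \<le> ns ! 0"
    and a0: "a (t, 0, 0) \<noteq> 0"
    and det: "ns ! 0 + e t \<ge> 2 \<Longrightarrow> x (t, 0, 1) * a (t, 0, 0) \<noteq> x (t, 0, 0) * a (t, 0, 1)"
  shows "pencil_type (block_labels t ns) (column_labels e t ns) (eval_action e x) (eval_action e a)
     (map (Jordan (Fin (x (t, 0, 0) / a (t, 0, 0)))) ns)"
proof -
  let ?f = "eval_action e x" and ?g = "eval_action e a"
  define \<mu> where "\<mu> = x (t, 0, 0) / a (t, 0, 0)"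
  define \<delta> where "\<delta> = 1 - e t"
  have \<delta>e: "\<delta> + e t = 1" using e by (simp add: \<delta>_def)
  \<comment> \<open>Generating series of the coordinates at block \<open>m\<close>:
    \<open>H y 0\<close> gives the diagonal blocks, and \<open>H y m\<close> for
    \<open>m > 0\<close> the coupling.\<close>
  define H where "H y m = Abs_fps (\<lambda>l. y (t, m, l))" for y :: "label \<Rightarrow> complex" and m :: nat
  have Hn: "H y m $ l = y (t, m, l)" for y m l by (simp add: H_def)
  define R where "R m = map (\<lambda>i. (t, m, i)) [0..<ns ! m]" for m
  define C where "C m = map (\<lambda>j. (t, m, if m = 0 then j + e t else j)) [0..<ns ! m]" for m
  define ms where "ms = [1..<length ns]"
  have upt: "[0..<length ns] = 0 # ms" using ns(1) by (simp add: ms_def upt_conv_Cons)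
  have rows: "block_labels t ns = R 0 @ concat (map R ms)"
    unfolding block_labels_def R_def[symmetric] upt by simp
  have cols: "column_labels e t ns = C 0 @ concat (map C ms)"
    unfolding column_labels_def C_def[symmetric] upt by simp
  have blocks: "map (Jordan (Fin \<mu>)) ns = [Jordan (Fin \<mu>) (ns ! 0)] @ concat (map (\<lambda>m. [Jordan (Fin \<mu>) (ns ! m)]) ms)"
    unfolding concat_map_singleton map_nth_upt[symmetric, of "Jordan (Fin \<mu>)" ns] upt by simp
  have ms: "m \<in> set ms \<longleftrightarrow> 1 \<le> m \<and> m < length ns" for m by (auto simp: ms_def)
  have lens: "length (R m) = ns ! m" "length (C m) = ns ! m" for m by (auto simp: R_def C_def)
  have memR: "(s, r, i) \<in> set (R m) \<longleftrightarrow> s = t \<and> r = m \<and> i < ns ! m" for s r i m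
    by (auto simp: R_def)
  have memC0: "(s, r, i) \<in> set (C 0) \<longleftrightarrow> s = t \<and> r = 0 \<and> e t \<le> i \<and> i < ns ! 0 + e t" for s r i
    by (auto simp: C_def intro!: image_eqI[of _ _ "i - e t"])
  have memC: "(s, r, i) \<in> set (C m) \<longleftrightarrow> s = t \<and> r = m \<and> i < ns ! m" if "m \<ge> 1" for s r i m
    using that by (auto simp: C_def)
  have diag: "pencil_type (R m) (C m) ?f ?g [Jordan (Fin \<mu>) (ns ! m)]" if m: "m < length ns" for m
  proof (rule pencil_type_toeplitz[OF lens ns(2)[OF m], where F = "H x 0" and G = "H a 0"])
    show "H a 0 $ 0 \<noteq> 0" "\<mu> = H x 0 $ 0 / H a 0 $ 0" using a0 by (auto simp: Hn \<mu>_def)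
    show "H x 0 $ 1 * H a 0 $ 0 \<noteq> H x 0 $ 0 * H a 0 $ 1" if "ns ! m \<ge> 2"
    proof -
      have "ns ! 0 \<ge> ns ! m" using dom[of m] m by (cases "m = 0") auto
      with that show ?thesis using det by (simp add: Hn)
    qed
  next
    fix i j assume "i < ns ! m" "j < ns ! m"
    thus "?f (R m ! i) (C m ! j) = (if i \<le> j then H x 0 $ (j - i) else 0)"
      and "?g (R m ! i) (C m ! j) = (if i \<le> j then H a 0 $ (j - i) else 0)"
      by (auto simp: R_def C_def eval_action_def Hn)
  qed
  \<comment> \<open>A single pair \<open>A\<close>, \<open>B\<close> has to uncouple the forms of
    \<open>x\<close> and \<open>a\<close> together. This is a linear system of two equations whose
    determinant has, by \<open>det\<close>, nonzero constant term.\<close>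
  have "\<exists>A B. A * fps_deriv (H x 0) - B * H x 0 = H x m \<and> A * fps_deriv (H a 0) - B * H a 0 = H a m"
    if m: "1 \<le> m" "m < length ns" for m
  proof -
    have "ns ! 0 + e t \<ge> 2" using dom[OF m] ns(2)[OF m(2)] e by linarith
    hence "fps_deriv (H x 0) $ 0 * H a 0 $ 0 \<noteq> fps_deriv (H a 0) $ 0 * H x 0 $ 0"
      using det by (simp add: Hn mult.commute)
    moreover have "H a 0 $ 0 \<noteq> 0" using a0 by (simp add: Hn)
    ultimately show ?thesis by (metis fps_cramer)
  qed
  then obtain A B where AB: "\<And>m. 1 \<le> m \<Longrightarrow> m < length ns \<Longrightarrow>
      A m * fps_deriv (H x 0) - B m * H x 0 = H x m \<and> A m * fps_deriv (H a 0) - B m * H a 0 = H a m"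
    by metis
  \<comment> \<open>The coefficient series are selected by the block being uncoupled. In
    \<open>\<sigma>\<close>, subtracting \<open>e t\<close> turns a column label of block 0 back
    into its position.\<close>
  define \<tau> where "\<tau> = (\<lambda>(p :: label) (k :: label). row_shear \<delta> (A (fst (snd k))) (snd (snd p)) (snd (snd k)))"
  define \<sigma> where "\<sigma> = (\<lambda>(k :: label) (q :: label).
     col_shear \<delta> (e t) (A (fst (snd q))) (B (fst (snd q))) (snd (snd k) - e t) (snd (snd q)))"
  have shear: "eval_action e y p q + (\<Sum>k\<in>set (concat (map R ms)). \<tau> p k * eval_action e y k q)
      + (\<Sum>k\<in>set (C 0). eval_action e y p k * \<sigma> k q) = 0"
    if y: "\<And>m. 1 \<le> m \<Longrightarrow> m < length ns \<Longrightarrow> A m * fps_deriv (H y 0) - B m * H y 0 = H y m"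
      and p: "p \<in> set (R 0)" and q: "q \<in> set (concat (map C ms))" for y p q
  proof -
    obtain i where i: "p = (t, 0, i)" by (cases p; use p in \<open>auto simp: memR\<close>)
    obtain m j where j: "q = (t, m, j)" "1 \<le> m" "m < length ns" "j < ns ! m"
      by (cases q; use q in \<open>auto simp: ms memC\<close>)
    have mm: "m \<in> set ms" using j by (simp add: ms)
    have 1: "(\<Sum>k\<in>set (concat (map R ms)). \<tau> p k * eval_action e y k q)
        = (\<Sum>k<ns ! m. row_shear \<delta> (A m) i k * (if k \<le> j then H y 0 $ (j - k) else 0))"
    proof -
      have "(\<Sum>k\<in>set (concat (map R ms)). \<tau> p k * eval_action e y k q)
         = (\<Sum>k<ns ! m. \<tau> p (t, m, k) * eval_action e y (t, m, k) q)"
      proof (rule sum_block_support)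
        fix z assume z: "z \<in> set (concat (map R ms))" "z \<notin> (\<lambda>k. (t, m, k)) ` {..<ns ! m}"
        obtain s r k where zz: "z = (s, r, k)" by (cases z)
        with z have "r \<in> set ms" "r \<noteq> m" by (auto simp: memR)
        thus "\<tau> p z * eval_action e y z q = 0"
          by (simp add: zz eval_action_def j(1) ms)
      qed (use mm in \<open>auto simp: memR inj_on_def\<close>)
      also have "\<dots> = (\<Sum>k<ns ! m. row_shear \<delta> (A m) i k * (if k \<le> j then H y 0 $ (j - k) else 0))"
        using j(2) by (intro sum.cong) (auto simp: \<tau>_def i j(1) eval_action_def Hn)
      finally show ?thesis .
    qed
    have 2: "(\<Sum>k\<in>set (C 0). eval_action e y p k * \<sigma> k q)
        = (\<Sum>k<ns ! 0. (if i \<le> k then H y 0 $ (k - i) else 0) * col_shear \<delta> (e t) (A m) (B m) k j)"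
    proof -
      have "(\<Sum>k\<in>set (C 0). eval_action e y p k * \<sigma> k q)
         = (\<Sum>k<ns ! 0. eval_action e y p (t, 0, k + e t) * \<sigma> (t, 0, k + e t) q)"
        by (rule sum_block_support) (auto simp: C_def inj_on_def)
      also have "\<dots> = (\<Sum>k<ns ! 0. (if i \<le> k then H y 0 $ (k - i) else 0) * col_shear \<delta> (e t) (A m) (B m) k j)"
        by (intro sum.cong) (auto simp: \<sigma>_def i j(1) eval_action_def Hn)
      finally show ?thesis .
    qed
    have 3: "eval_action e y p q = (if i + e t \<le> j then H y m $ (j - i - e t) else 0)"
      by (simp add: i j(1) eval_action_def Hn)
    show ?thesis unfolding 1 2 3
      by (rule shear_identity[OF \<delta>e _ j(4) y[OF j(2,3)]]) (use dom[OF j(2,3)] in \<open>simp add: \<delta>_def\<close>)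
  qed
  have rest: "pencil_type (concat (map R ms)) (concat (map C ms)) ?f ?g (concat (map (\<lambda>m. [Jordan (Fin \<mu>) (ns ! m)]) ms))"
  proof (rule pencil_type_concat)
    fix k p q k' assume "k \<in> set ms" "k' \<in> set ms" "k \<noteq> k'" "p \<in> set (R k)" "q \<in> set (C k')"
    then show "?f p q = 0 \<and> ?g p q = 0"
      by - (cases p; cases q; auto simp: ms memR memC eval_action_def)
  qed (use diag in \<open>auto simp: ms ms_def\<close>)
  have "pencil_type (R 0 @ concat (map R ms)) (C 0 @ concat (map C ms)) ?f ?g
     ([Jordan (Fin \<mu>) (ns ! 0)] @ concat (map (\<lambda>m. [Jordan (Fin \<mu>) (ns ! m)]) ms))"
  proof (rule pencil_type_shear[where \<tau> = \<tau> and \<sigma> = \<sigma>])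
    show "distinct (concat (map R ms))" "distinct (C 0)"
      using distinct_block_labels[of t ns] distinct_column_labels[of e t ns] unfolding rows cols by auto
    show "?f p q = 0 \<and> ?g p q = 0" if "p \<in> set (concat (map R ms))" "q \<in> set (C 0)" for p q
      by (cases p; cases q; use that in \<open>auto simp: ms memR memC0 eval_action_def\<close>)
    show "pencil_type (R 0) (C 0) ?f ?g [Jordan (Fin \<mu>) (ns ! 0)]"
      using diag[of 0] ns(1) by simp
  qed (use AB shear rest in auto)
  thus ?thesis unfolding rows cols \<mu>_def[symmetric] blocks .
qed

unbundle no fps_syntax
notation vec_index (infixl "$" 100)

text \<open>The index \<open>c\<close> selects the only tuple whose largest block may be repeated;
  \<open>c = length N\<close> means that there is none. In both cases \<open>(c, 0, 0)\<close>
  supplies the Kronecker block.\<close>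

lemma jk_realization_one_central:
  fixes N :: "nat list list"
  assumes c: "c \<le> length N" and ne: "\<And>t. t < length N \<Longrightarrow> N ! t \<noteq> []"
    and pos: "\<And>t m. t < length N \<Longrightarrow> m < length (N ! t) \<Longrightarrow> N ! t ! m \<ge> 1"
    and dom: "\<And>t m. t < length N \<Longrightarrow> 1 \<le> m \<Longrightarrow> m < length (N ! t) \<Longrightarrow>
      N ! t ! m + (if t = c then 0 else 1) \<le> N ! t ! 0"
  shows "\<exists>n s. lie_algebra n s \<and> jk_invariants n s ({#1#}, mset (map mset N))"
proof -
  define L where "L = length N"
  define e :: "nat \<Rightarrow> nat" where "e t = (if t = c then 1 else 0)" for t
  define Ps where "Ps = concat (map (\<lambda>t. block_labels t (N ! t)) [0..<L])"
  define Cs where "Cs = concat (map (\<lambda>t. column_labels e t (N ! t)) [0..<L])"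
  \<comment> \<open>For \<open>c < L\<close> the added label is the one set aside in tuple
    \<open>c\<close>; for \<open>c = L\<close> it is a new label on which no row acts.\<close>
  define Qs where "Qs = Cs @ [(c, 0, 0)]"
  define \<rho> :: "label \<Rightarrow> label \<Rightarrow> label \<Rightarrow> complex"
    where "\<rho> p q k = (if shift_action e p q = Some k then 1 else 0)" for p q k
  define n where "n = length Ps + length Qs"
  have Ps: "(t, m, i) \<in> set Ps \<longleftrightarrow> t < L \<and> m < length (N ! t) \<and> i < N ! t ! m" for t m i
    by (auto simp: Ps_def set_block_labels)
  have Cs: "(t, m, j) \<in> set Cs \<longleftrightarrow> t < L \<and> m < length (N ! t) \<and>
      (if m = 0 then e t \<le> j \<and> j < N ! t ! m + e t else j < N ! t ! m)" for t m j
    by (auto simp: Cs_def set_column_labels)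
  have Qs: "(t, m, j) \<in> set Qs \<longleftrightarrow> (t, m, j) \<in> set Cs \<or> (t = c \<and> m = 0 \<and> j = 0)" for t m j
    by (auto simp: Qs_def)
  have dist: "distinct Qs"
  proof -
    have "distinct Cs" unfolding Cs_def
      by (rule distinct_concat_map) (auto simp: distinct_column_labels set_column_labels)
    moreover have "(c, 0, 0) \<notin> set Cs" by (simp add: Cs e_def)
    ultimately show ?thesis by (simp add: Qs_def)
  qed
  \<comment> \<open>The structure constants only see targets in \<open>Qs\<close>, so the action
    must not leave it. For rows with \<open>m > 0\<close> this uses \<open>dom\<close>, as they map
    block \<open>m\<close> into block 0.\<close>
  have closed: "k \<in> set Qs" if "p \<in> set Ps" "q \<in> set Qs" "shift_action e p q = Some k" for p q k
  proof -
    obtain t m i where p: "p = (t, m, i)" by (cases p)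
    obtain t' m' j where q: "q = (t', m', j)" by (cases q)
    have p': "t < L" "m < length (N ! t)" "i < N ! t ! m" using that(1) by (auto simp: p Ps)
    show ?thesis
    proof (cases "m = 0")
      case True
      thus ?thesis using that p' by (auto simp: p q Qs Cs e_def split: if_splits)
    next
      case False
      hence k: "k = (t, 0, j - i)" "t' = t" "m' = m" "i \<le> j" using that(3) by (auto simp: p q split: if_splits)
      have "j < N ! t ! m" using that(2) False by (auto simp: q k Qs Cs)
      thus ?thesis using dom[of t m] p' False ne[of t] unfolding k Qs Cs e_def L_def by auto
    qed
  qed
  have comp: "(\<Sum>k\<in>set Qs. \<rho> p q k * \<rho> p' k s) =
      (if Option.bind (shift_action e p q) (shift_action e p') = Some s then 1 else 0)"
    if "p \<in> set Ps" "q \<in> set Qs" for p p' q s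
  proof (cases "shift_action e p q")
    case None
    thus ?thesis by (simp add: \<rho>_def)
  next
    case (Some k)
    have "(\<Sum>l\<in>set Qs. \<rho> p q l * \<rho> p' l s) = (\<Sum>l\<in>set Qs. if l = k then \<rho> p' l s else 0)"
      by (intro sum.cong) (auto simp: \<rho>_def Some)
    thus ?thesis using closed[OF that Some] by (simp add: Some \<rho>_def)
  qed
  have lie: "lie_algebra n (semidirect_struct Ps Qs \<rho>)"
    unfolding n_def using dist
    by (rule lie_algebra_semidirect) (simp add: comp shift_action_commute)
  let ?y = "\<lambda>x. dual_coord (length Ps) Qs x"
  have form: "(\<Sum>k\<in>set Qs. ?y x k * \<rho> p q k) = eval_action e (?y x) p q"
    if "p \<in> set Ps" "q \<in> set Qs" for x p q
  proof (cases "shift_action e p q")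
    case None
    thus ?thesis by (simp add: \<rho>_def eval_action_def)
  next
    case (Some k)
    have "(\<Sum>l\<in>set Qs. ?y x l * \<rho> p q l) = (\<Sum>l\<in>set Qs. if l = k then ?y x l else 0)"
      by (intro sum.cong) (auto simp: \<rho>_def Some)
    thus ?thesis using closed[OF that Some] by (simp add: Some eval_action_def)
  qed
  define I where "I = {(i, j). i < j \<and> j < n}"
  have "I \<subseteq> {0..<n} \<times> {0..<n}" by (auto simp: I_def)
  hence finI: "finite I" by (rule finite_subset) simp
  \<comment> \<open>Nonzero coordinates of \<open>a\<close> and nonzero minors of
    \<open>(x, a)\<close> supply the denominators, the distinct eigenvalues and the determinant
    condition inside each tuple at once.\<close>
  define F where "F = (\<lambda>p :: complex vec \<times> complex vec. (\<Prod>i\<in>{0..<n}. snd p $ i) *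
     (\<Prod>s\<in>I. fst p $ fst s * snd p $ snd s - fst p $ snd s * snd p $ fst s))"
  have polyF: "poly_fun n F"
    unfolding F_def using finI
    by (intro poly_fun.mult poly_fun_prod poly_fun_diff poly_fun.intros) (auto simp: I_def)
  have "jk_invariants n (semidirect_struct Ps Qs \<rho>) ({#1#}, mset (map mset N))"
  proof (rule jk_invariants_semidirect[OF dist polyF[unfolded n_def], folded n_def])
    \<comment> \<open>With \<open>x = (0, 1, 2, ...)\<close> and \<open>a = (1, 1, 1, ...)\<close>
      the minors are the differences of distinct indices.\<close>
    show "F (vec n of_nat, vec n (\<lambda>_. 1)) \<noteq> 0"
      using finI by (auto simp: F_def I_def prod_zero_iff)
  next
    fix x a :: "complex vec"
    assume "F (x, a) \<noteq> 0"
    hence nzv: "\<And>i. i < n \<Longrightarrow> a $ i \<noteq> 0"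
      and detv': "\<And>i j. (i, j) \<in> I \<Longrightarrow> x $ i * a $ j \<noteq> x $ j * a $ i"
      using finI by (auto simp: F_def)
    have detv: "x $ i * a $ j \<noteq> x $ j * a $ i" if "i < n" "j < n" "i \<noteq> j" for i j
      using detv'[of i j] detv'[of j i] that by (cases "i < j") (auto simp: I_def)
    have pt: "\<exists>i<length Qs. q = Qs ! i" if "q \<in> set Qs" for q
      using that by (metis in_set_conv_nth)
    have nz: "?y a q \<noteq> 0" if "q \<in> set Qs" for q
      using pt[OF that] nzv dual_coord_nth[OF dist] by (auto simp: n_def)
    have det: "?y x q * ?y a q' \<noteq> ?y x q' * ?y a q" if qs: "q \<in> set Qs" "q' \<in> set Qs" "q \<noteq> q'" for q q'
    proof -
      obtain i j where ij: "i < length Qs" "j < length Qs" "q = Qs ! i" "q' = Qs ! j"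
        using pt[OF qs(1)] pt[OF qs(2)] by blast
      with qs(3) have "i \<noteq> j" by auto
      thus ?thesis using detv[of "length Ps + i" "length Ps + j"] ij(1,2)
        unfolding ij(3,4) by (simp add: n_def dual_coord_nth[OF dist])
    qed
    define \<mu> where "\<mu> t = ?y x (t, 0, 0) / ?y a (t, 0, 0)" for t :: nat
    have top: "(t, 0, 0) \<in> set Qs" if "t < L" for t
      using that pos[of t 0] ne[of t] by (auto simp: Qs Cs e_def L_def)
    have inj: "inj_on \<mu> {0..<length N}"
    proof (rule inj_onI, rule ccontr)
      fix s t assume st: "s \<in> {0..<length N}" "t \<in> {0..<length N}" "\<mu> s = \<mu> t" "s \<noteq> t"
      hence m: "(s, 0, 0) \<in> set Qs" "(t, 0, 0) \<in> set Qs" using top by (auto simp: L_def)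
      have "?y x (s, 0, 0) * ?y a (t, 0, 0) = ?y x (t, 0, 0) * ?y a (s, 0, 0)"
        using st(3) nz[OF m(1)] nz[OF m(2)] by (simp add: \<mu>_def frac_eq_eq)
      thus False using det[OF m] st(4) by simp
    qed
    let ?f = "eval_action e (?y x)" and ?g = "eval_action e (?y a)"
    have main: "pencil_type (concat (map (\<lambda>t. block_labels t (N ! t)) [0..<L]))
        (concat (map (\<lambda>t. column_labels e t (N ! t)) [0..<L])) ?f ?g
        (concat (map (\<lambda>t. map (Jordan (Fin (\<mu> t))) (N ! t)) [0..<L]))"
    proof (rule pencil_type_concat)
      fix k p q k'
      assume "k \<noteq> k'" "p \<in> set (block_labels k (N ! k))" "q \<in> set (column_labels e k' (N ! k'))"
      then show "?f p q = 0 \<and> ?g p q = 0"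
        by - (cases p; cases q; auto simp: set_block_labels set_column_labels eval_action_def)
    next
      fix t assume "t \<in> set [0..<L]"
      hence t: "t < L" "t < length N" by (auto simp: L_def)
      show "pencil_type (block_labels t (N ! t)) (column_labels e t (N ! t)) ?f ?g
          (map (Jordan (Fin (\<mu> t))) (N ! t))"
        unfolding \<mu>_def
      proof (rule pencil_type_tuple)
        show "?y a (t, 0, 0) \<noteq> 0" using nz[OF top[OF t(1)]] .
        show "?y x (t, 0, 1) * ?y a (t, 0, 0) \<noteq> ?y x (t, 0, 0) * ?y a (t, 0, 1)" if "N ! t ! 0 + e t \<ge> 2"
        proof -
          have "(t, 0, 1) \<in> set Qs" using that t ne[of t] by (auto simp: Qs Cs e_def)
          thus ?thesis by (rule det[OF _ top[OF t(1)]]) simp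
        qed
        show "N ! t ! m + (1 - e t) \<le> N ! t ! 0" if "1 \<le> m" "m < length (N ! t)" for m
          using dom[OF t(2) that] by (auto simp: e_def)
      qed (use ne pos t in \<open>auto simp: e_def\<close>)
    qed auto
    have "pencil_type (Ps @ []) (Cs @ [(c, 0, 0)]) ?f ?g
        (concat (map (\<lambda>t. map (Jordan (Fin (\<mu> t))) (N ! t)) [0..<L]) @ replicate (length [(c, 0::nat, 0::nat)]) (Kron 1))"
    proof (rule pencil_type_append[OF _ _ main[folded Ps_def Cs_def] pencil_type_Kron1])
      fix p q assume "p \<in> set Ps" "q \<in> set [(c, 0::nat, 0::nat)]"
      then show "?f p q = 0 \<and> ?g p q = 0"
        by - (cases p; auto simp: eval_action_def e_def)
    qed auto
    hence "pencil_type Ps Qs ?f ?g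
        (concat (map (\<lambda>t. map (Jordan (Fin (\<mu> t))) (N ! t)) [0..<L]) @ replicate 1 (Kron 1))"
      by (simp add: Qs_def)
    hence "pencil_type Ps Qs (\<lambda>p v. \<Sum>k\<in>set Qs. ?y x k * \<rho> p v k) (\<lambda>p v. \<Sum>k\<in>set Qs. ?y a k * \<rho> p v k)
        (concat (map (\<lambda>t. map (Jordan (Fin (\<mu> t))) (N ! t)) [0..<L]) @ replicate 1 (Kron 1))"
      by (rule pencil_type_cong[rotated 2]) (simp_all add: form)
    thus "\<exists>bs. pencil_type Ps Qs (\<lambda>p v. \<Sum>k\<in>set Qs. ?y x k * \<rho> p v k)
        (\<lambda>p v. \<Sum>k\<in>set Qs. ?y a k * \<rho> p v k) bs \<and> jk_data bs = ({#1#}, mset (map mset N))"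
      using jk_data_blocks[OF ne inj, of 1] unfolding L_def by auto
  qed auto
  with lie show ?thesis by blast
qed

section \<open>Ordering the tuples and choosing the central element\<close>

text \<open>The first entry of a decreasing list is its maximum, so a later entry that reaches it is
  a second copy. Conversely, without multiple maxima the later blocks are strictly smaller, as the
  shear with \<open>e t = 0\<close> requires.\<close>

lemma multiple_maximaI:
  assumes "sorted (rev xs)" "1 \<le> m" "m < length xs" "xs ! 0 \<le> xs ! m"
  shows "multiple_maxima (mset xs)"
proof -
  obtain y ys where xs: "xs = y # ys" using assms(3) by (cases xs) auto
  have top: "z \<le> xs ! 0" if z: "z \<in> set xs" for z
    using z sorted_rev_nth_mono[OF assms(1), of 0] by (auto simp: in_set_conv_nth)
  have "Max_mset (mset xs) = xs ! 0"
    using top assms(3) by (intro Max_eqI) (auto simp: xs)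
  moreover have "xs ! m = y" using top[of "xs ! m"] assms by (auto simp: xs)
  hence "y \<in> set ys" using assms(2,3) by (cases m) (auto simp: xs)
  hence "count (mset ys) y \<ge> 1" by (simp add: count_greater_zero_iff Suc_le_eq)
  ultimately show ?thesis using assms(2,3) by (auto simp: multiple_maxima_def xs)
qed

lemma decreasing_lists_of_tuples:
  assumes "\<forall>t\<in>#T. jordan_tuple t"
  obtains N where "mset (map mset N) = T" "\<And>t. t < length N \<Longrightarrow> N ! t \<noteq> []"
    "\<And>t m. t < length N \<Longrightarrow> m < length (N ! t) \<Longrightarrow> N ! t ! m \<ge> 1"
    "\<And>t. t < length N \<Longrightarrow> sorted (rev (N ! t))"
proof -
  obtain ts where ts: "mset ts = T" using ex_mset by blast
  define N where "N = map (\<lambda>t. rev (sorted_list_of_multiset t)) ts"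
  have eq: "map mset N = ts" by (simp add: N_def comp_def)
  have jt: "jordan_tuple (mset (N ! t))" if "t < length N" for t
    using assms that ts eq by (metis length_map nth_map nth_mem set_mset_mset)
  show thesis
  proof (rule that[of N])
    show "mset (map mset N) = T" unfolding eq by (rule ts)
    show "N ! t \<noteq> []" if "t < length N" for t
      using jt[OF that] by (auto simp: jordan_tuple_def)
    show "N ! t ! m \<ge> 1" if "t < length N" "m < length (N ! t)" for t m
      using jt[OF that(1)] that(2) by (auto simp: jordan_tuple_def)
    show "sorted (rev (N ! t))" if "t < length N" for t
      using that by (simp add: N_def)
  qed
qed

theorem theorem14:
  shows "(\<forall>T. (\<forall>t\<in>#T. jordan_tuple t) \<and> size (filter_mset multiple_maxima T) \<le> 1 \<longrightarrow>
            (\<exists>n c. lie_algebra n c \<and> jk_invariants n c ({#1#}, T)))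
       \<and> (\<forall>q::nat. \<forall>T. q \<ge> 2 \<and> (\<forall>t\<in>#T. jordan_tuple t) \<longrightarrow>
            (\<exists>n c. lie_algebra n c \<and> jk_invariants n c (replicate_mset q 1, T)))"
proof (intro conjI allI impI; elim conjE)
  fix T assume T: "\<forall>t\<in>#T. jordan_tuple t" and one: "size (filter_mset multiple_maxima T) \<le> 1"
  obtain N where N: "mset (map mset N) = T" "\<And>t. t < length N \<Longrightarrow> N ! t \<noteq> []"
    "\<And>t m. t < length N \<Longrightarrow> m < length (N ! t) \<Longrightarrow> N ! t ! m \<ge> 1"
    "\<And>t. t < length N \<Longrightarrow> sorted (rev (N ! t))"
    by (rule decreasing_lists_of_tuples[OF T]) blast
  define S where "S = {t. t < length N \<and> multiple_maxima (mset (N ! t))}"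
  have "length (filter multiple_maxima (map mset N)) \<le> 1"
    using one unfolding N(1)[symmetric] mset_filter[symmetric] size_mset .
  hence "card S \<le> 1"
    unfolding length_filter_conv_card S_def by (simp cong: conj_cong)
  moreover have "finite S" by (simp add: S_def)
  ultimately have uniq: "\<And>s t. s \<in> S \<Longrightarrow> t \<in> S \<Longrightarrow> s = t"
    using card_le_Suc0_iff_eq[of S] by auto
  \<comment> \<open>The exceptional tuple is the unique element of \<open>S\<close>; if
    \<open>S\<close> is empty, \<open>length N\<close> lies outside the tuple indices and the strict
    bound is required of all tuples.\<close>
  define c where "c = (if S = {} then length N else (SOME t. t \<in> S))"
  have cS: "c \<in> S" if "S \<noteq> {}" using that some_in_eq[of S] by (simp add: c_def)
  have "\<exists>n s. lie_algebra n s \<and> jk_invariants n s ({#1#}, mset (map mset N))"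
  proof (rule jk_realization_one_central[OF _ N(2,3)])
    show "c \<le> length N" using cS by (cases "S = {}") (auto simp: S_def c_def)
    fix t m assume tm: "t < length N" "1 \<le> m" "m < length (N ! t)"
    have le: "N ! t ! m \<le> N ! t ! 0"
      using sorted_rev_nth_mono[OF N(4)[OF tm(1)], of 0 m] tm(3) by simp
    show "N ! t ! m + (if t = c then 0 else 1) \<le> N ! t ! 0"
    proof (cases "N ! t ! 0 \<le> N ! t ! m")
      case True
      hence "t \<in> S" using multiple_maximaI[OF N(4)[OF tm(1)] tm(2,3)] tm(1) by (simp add: S_def)
      hence "t = c" using uniq cS by blast
      thus ?thesis using le by simp
    qed auto
  qed
  thus "\<exists>n c. lie_algebra n c \<and> jk_invariants n c ({#1#}, T)" unfolding N(1) .
next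
  fix q :: nat and T assume q: "q \<ge> 2" and T: "\<forall>t\<in>#T. jordan_tuple t"
  obtain N where N: "mset (map mset N) = T" "\<And>t. t < length N \<Longrightarrow> N ! t \<noteq> []"
    "\<And>t m. t < length N \<Longrightarrow> m < length (N ! t) \<Longrightarrow> N ! t ! m \<ge> 1"
    using decreasing_lists_of_tuples[OF T] by metis
  show "\<exists>n c. lie_algebra n c \<and> jk_invariants n c (replicate_mset q 1, T)"
    using jk_realization_two_central[OF N(2,3) q] unfolding N(1) by blast
qed

end
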